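(* For every Boolean function $f$ on $n\ge1$ bits and every $p\in(1/2,1)$, $$\kappa_c(f,p)\ \le\ \kappa_0(n,p):=\frac{1}{1+\frac1n\left(\frac{1-p}{2}\right)^n}.$$
   Context: $[n]=\{1,\dots,n\}$. Standard complexity: a standard algorithm queries the bits of $x\in\{0,1\}^n$ one by one, the next queried bit being allowed to depend on the outcomes of all previous queries; $a(f,\pi_{1/2})$ is the minimum over such algorithms of the expected number of queries, for uniformly random $x$, until $f$ is determined (i.e. $f$ is constant on all inputs agreeing with the queried values). Partial information model: fix $p\in(1/2,1)$. For $1\le i\le n$ let $x_i$ be independent Brownian motions started at $1/2$ and stopped when hitting $\{0,1\}$; let $Z_i$ be the indicator that $x_i$ hits $p$ before $1-p$, and $X_i\in\{0,1\}$ the value at which $x_i$ is stopped. Thus the pairs $(Z_i,X_i)$ are i.i.d. over $i$, $Z_i$ and $X_i$ are Ber$(1/2)$, and $\mathbb P[X_i=Z_i]=p$. An algorithm $A\in\mathcal A_p$ is a sequence of random (ordered) partitions $A=(A^0_t,A^1_t,A^2_t)_{0\le t\le 2n}$ of $[n]$ such that $A_0=([n],\emptyset,\emptyset)$, $A_{2n}=(\emptyset,\emptyset,[n])$, and for every $t\in\{1,\dots,2n\}$: $A_t$ is obtained from $A_{t-1}$ by moving one element either from $A^0_{t-1}$ to $A^1_{t-1}$ (querying $Z_i$) or from $A^1_{t-1}$ to $A^2_{t-1}$ (querying $X_i$), and $A_t$ is measurable with respect to $A_{t-1}$, $(Z_i)_{i\in A^1_{t-1}}$ and $(X_i)_{i\in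 A^2_{t-1}}$. Let $T_A=T_A(f)=\min\{t\ge0: f\text{ is determined by }(X_i)_{i\in A^2_t}\}$. For $\kappa\in[0,1]$ the cost of $A$ is $c_{p,\kappa}(A,f)=\mathbb E[\kappa|A^1_{T_A}|+|A^2_{T_A}|]$, and $a_{p,\kappa}(f,\pi_{1/2})=\min_{A\in\mathcal A_p}c_{p,\kappa}(A,f)$. Finally $\kappa_c(f,p)=\inf\{\kappa\in[0,1]:a_{p,\kappa}(f,\pi_{1/2})=a(f,\pi_{1/2})\}$. *)

theory Defs
  imports "HOL-Probability.Probability"
begin

definition cube :: "nat \<Rightarrow> (nat \<Rightarrow> bool) set" where
  "cube n = {1..n} \<rightarrow>\<^sub>E UNIV"

text \<open>A Boolean function on \<open>n\<close> bits is a function \<open>f\<close> on assignments of which only the values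
  on \<open>cube n\<close> matter. Only the values of \<open>x\<close> on \<open>S\<close> matter in the following definition.\<close>

definition determined :: "nat \<Rightarrow> ((nat \<Rightarrow> bool) \<Rightarrow> bool) \<Rightarrow> nat set \<Rightarrow> (nat \<Rightarrow> bool) \<Rightarrow> bool" where
  "determined n f S x \<longleftrightarrow> (\<exists>c. \<forall>y\<in>cube n. (\<forall>i\<in>S. y i = x i) \<longrightarrow> f y = c)"

text \<open>A standard algorithm maps the history of the previous queries (queried bits with their
  outcomes, in order) to the next bit to query. Termination plays no role in the algorithm
  itself: it queries all \<open>n\<close> bits, and the cost counts queries until \<open>f\<close> is determined.\<close>

type_synonym strategy = "(nat \<times> bool) list \<Rightarrow> nat"

primrec history :: "strategy \<Rightarrow> (nat \<Rightarrow> bool) \<Rightarrow> nat \<Rightarrow> (nat \<times> bool) list" where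
  "history q x 0 = []"
| "history q x (Suc t) = history q x t @ [(q (history q x t), x (q (history q x t)))]"

definition queried :: "strategy \<Rightarrow> (nat \<Rightarrow> bool) \<Rightarrow> nat \<Rightarrow> nat set" where
  "queried q x t = fst ` set (history q x t)"

definition standard_algorithms :: "nat \<Rightarrow> strategy set" where
  "standard_algorithms n =
     {q. \<forall>x\<in>cube n. \<forall>t<n. q (history q x t) \<in> {1..n} - queried q x t}"

definition num_queries :: "nat \<Rightarrow> ((nat \<Rightarrow> bool) \<Rightarrow> bool) \<Rightarrow> strategy \<Rightarrow> (nat \<Rightarrow> bool) \<Rightarrow> nat" where
  "num_queries n f q x = (LEAST t. determined n f (queried q x t) x)"

text \<open>Here and in \<open>partial_complexity\<close> below, only finitely many cost values occur (and at
  least one does), so the infimum is a minimum.\<close>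

definition standard_complexity :: "nat \<Rightarrow> ((nat \<Rightarrow> bool) \<Rightarrow> bool) \<Rightarrow> real" where
  "standard_complexity n f =
     (INF q\<in>standard_algorithms n.
        measure_pmf.expectation (pmf_of_set (cube n)) (\<lambda>x. real (num_queries n f q x)))"

text \<open>The pairs \<open>(Z i, X i)\<close> are i.i.d.; the three one-coordinate probabilities determine their
  common law. The motivating instance is: \<open>X i\<close> is the endpoint in \<open>{0,1}\<close> of a Brownian motion
  started at \<open>1/2\<close>, and \<open>Z i\<close> tells whether it hits \<open>p\<close> before \<open>1 - p\<close>.\<close>

definition partial_information_model ::
    "'w measure \<Rightarrow> nat \<Rightarrow> real \<Rightarrow> (nat \<Rightarrow> 'w \<Rightarrow> bool) \<Rightarrow> (nat \<Rightarrow> 'w \<Rightarrow> bool) \<Rightarrow> bool" where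
  "partial_information_model M n p Z X \<longleftrightarrow>
     prob_space M \<and>
     prob_space.indep_vars M (\<lambda>_. count_space UNIV) (\<lambda>i \<omega>. (Z i \<omega>, X i \<omega>)) {1..n} \<and>
     (\<forall>i\<in>{1..n}.
        measure M {\<omega>\<in>space M. Z i \<omega>} = 1/2 \<and>
        measure M {\<omega>\<in>space M. X i \<omega>} = 1/2 \<and>
        measure M {\<omega>\<in>space M. X i \<omega> = Z i \<omega>} = p)"

text \<open>A state \<open>(A0, A1, A2)\<close> consists of the coordinates about which nothing, exactly \<open>Z i\<close>,
  and \<open>X i\<close> has been queried, respectively.\<close>

type_synonym state = "nat set \<times> nat set \<times> nat set"

abbreviation st0 :: "state \<Rightarrow> nat set" where "st0 a \<equiv> fst a"
abbreviation st1 :: "state \<Rightarrow> nat set" where "st1 a \<equiv> fst (snd a)"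
abbreviation st2 :: "state \<Rightarrow> nat set" where "st2 a \<equiv> snd (snd a)"

definition ordered_partition :: "nat \<Rightarrow> state \<Rightarrow> bool" where
  "ordered_partition n a \<longleftrightarrow>
     st0 a \<union> st1 a \<union> st2 a = {1..n} \<and>
     st0 a \<inter> st1 a = {} \<and> st0 a \<inter> st2 a = {} \<and> st1 a \<inter> st2 a = {}"

definition query_step :: "state \<Rightarrow> state \<Rightarrow> bool" where
  "query_step a b \<longleftrightarrow>
     (\<exists>i\<in>st0 a. b = (st0 a - {i}, insert i (st1 a), st2 a)) \<or>
     (\<exists>i\<in>st1 a. b = (st0 a, st1 a - {i}, insert i (st2 a)))"

text \<open>All random variables involved are discrete, so measurability of the next state with
  respect to the current state and the values revealed by it is expressed as functional
  dependence: sample points giving the same current state and the same revealed values have the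
  same next state.\<close>

definition partial_algorithms ::
    "'w measure \<Rightarrow> nat \<Rightarrow> (nat \<Rightarrow> 'w \<Rightarrow> bool) \<Rightarrow> (nat \<Rightarrow> 'w \<Rightarrow> bool) \<Rightarrow> (nat \<Rightarrow> 'w \<Rightarrow> state) set" where
  "partial_algorithms M n Z X =
     {A. (\<forall>\<omega>\<in>space M.
            A 0 \<omega> = ({1..n}, {}, {}) \<and>
            A (2 * n) \<omega> = ({}, {}, {1..n}) \<and>
            (\<forall>t\<le>2 * n. ordered_partition n (A t \<omega>)) \<and>
            (\<forall>t<2 * n. query_step (A t \<omega>) (A (Suc t) \<omega>))) \<and>
         (\<forall>t<2 * n. \<forall>\<omega>\<in>space M. \<forall>\<omega>'\<in>space M.
            A t \<omega> = A t \<omega>' \<and>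
            (\<forall>i\<in>st1 (A t \<omega>). Z i \<omega> = Z i \<omega>') \<and>
            (\<forall>i\<in>st2 (A t \<omega>). X i \<omega> = X i \<omega>') \<longrightarrow>
            A (Suc t) \<omega> = A (Suc t) \<omega>')}"

definition stop_time ::
    "nat \<Rightarrow> ((nat \<Rightarrow> bool) \<Rightarrow> bool) \<Rightarrow> (nat \<Rightarrow> 'w \<Rightarrow> bool) \<Rightarrow> (nat \<Rightarrow> 'w \<Rightarrow> state) \<Rightarrow> 'w \<Rightarrow> nat" where
  "stop_time n f X A \<omega> = (LEAST t. determined n f (st2 (A t \<omega>)) (\<lambda>i. X i \<omega>))"

definition partial_cost ::
    "'w measure \<Rightarrow> nat \<Rightarrow> (nat \<Rightarrow> 'w \<Rightarrow> bool) \<Rightarrow> real \<Rightarrow> (nat \<Rightarrow> 'w \<Rightarrow> state) \<Rightarrow>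
     ((nat \<Rightarrow> bool) \<Rightarrow> bool) \<Rightarrow> real" where
  "partial_cost M n X \<kappa> A f =
     (\<integral>\<omega>. \<kappa> * real (card (st1 (A (stop_time n f X A \<omega>) \<omega>)))
           + real (card (st2 (A (stop_time n f X A \<omega>) \<omega>))) \<partial>M)"

definition partial_complexity ::
    "'w measure \<Rightarrow> nat \<Rightarrow> (nat \<Rightarrow> 'w \<Rightarrow> bool) \<Rightarrow> (nat \<Rightarrow> 'w \<Rightarrow> bool) \<Rightarrow> real \<Rightarrow>
     ((nat \<Rightarrow> bool) \<Rightarrow> bool) \<Rightarrow> real" where
  "partial_complexity M n Z X \<kappa> f =
     (INF A\<in>partial_algorithms M n Z X. partial_cost M n X \<kappa> A f)"

definition kappa_c ::
    "'w measure \<Rightarrow> nat \<Rightarrow> (nat \<Rightarrow> 'w \<Rightarrow> bool) \<Rightarrow> (nat \<Rightarrow> 'w \<Rightarrow> bool) \<Rightarrow>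
     ((nat \<Rightarrow> bool) \<Rightarrow> bool) \<Rightarrow> real" where
  "kappa_c M n Z X f =
     Inf {\<kappa>\<in>{0..1}. partial_complexity M n Z X \<kappa> f = standard_complexity n f}"

definition kappa_0 :: "nat \<Rightarrow> real \<Rightarrow> real" where
  "kappa_0 n p = 1 / (1 + 1 / real n * ((1 - p) / 2) ^ n)"

end

theory Submission
  imports Defs
begin

text \<open>Put \<open>\<kappa> = kappa_0 n p\<close>. This is a number of \<open>[0,1]\<close>, so it bounds the infimum
  \<open>kappa_c\<close> once the two complexities are shown to agree at \<open>\<kappa>\<close>. It is
  the solution of \<open>\<kappa> \<delta> = (1 - \<kappa>) n\<close> with \<open>\<delta> = ((1 - p) / 2) ^ n\<close>, and the proof shows that
  a hint that is left unused makes an algorithm lose at least \<open>\<delta>\<close> standard queries on average.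

  The standard complexity \<open>a\<close> is computed by dynamic programming: it is the value of
  \<open>opt_value\<close> with nothing revealed (\<open>standard_complexity_eq\<close>). An algorithm that reads each bit
  right after its hint never stops with a pending hint, hence costs as much as the standard
  algorithm that it follows.

  For the converse, let \<open>A\<close> be any algorithm with partial information, stopped at \<open>T\<close>, and reveal
  the bit \<open>X i\<close> already when \<open>A\<close> asks for the hint \<open>Z i\<close>. At that time \<open>X i\<close> is a fair coin
  independent of all that was seen before, so this is a randomised standard algorithm, with
  \<open>|A1| + |A2|\<close> queries at time \<open>T\<close>. Its expected number of queries is \<open>a\<close> plus the expected sum
  of the regrets of its queries, where the regret of a query is the loss against an optimal one
  (\<open>expected_seen\<close>).

  If no hint is pending at \<open>T\<close>, then \<open>A\<close> itself pays for each of these queries, and its cost is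
  at least \<open>a\<close>. If the hint of some \<open>i\<close> is pending at \<open>T\<close> for some outcome, then some query has
  positive regret: \<open>A\<close> has asked the same questions for both values of \<open>X i\<close>, so if all of them
  were optimal, the query of \<open>i\<close> could be postponed until \<open>T\<close> without loss (\<open>postpone_query\<close>);
  but then \<open>f\<close> is determined without \<open>X i\<close>, and the query of \<open>i\<close> is a loss
  (\<open>wasted_hint_regret\<close>). With \<open>m\<close> bits still unrevealed, all values are multiples of
  \<open>2 ^ (- m)\<close>, so a positive regret is at least that; and what has been seen then has probability
  at least \<open>((1 - p) / 2) ^ (n - m)\<close>. So the expected total regret is at least \<open>\<delta>\<close>
  (\<open>total_regret_ge\<close>), and the cost of \<open>A\<close> is at least
  \<open>\<kappa> (a + \<delta>) = \<kappa> a + (1 - \<kappa>) n\<close>, which is at least \<open>a\<close> because \<open>a \<le> n\<close>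
  (\<open>cost_lower_bound\<close>).

  All of this takes place on the finite space of the \<open>4 ^ n\<close> values of the pairs \<open>(Z i, X i)\<close>.
  An algorithm on an arbitrary sample space is a function of these pairs, and every
  value of the pairs occurs there since it has positive probability
  (\<open>canonical_representation\<close>).\<close>

section \<open>The optimal remaining cost of standard algorithms\<close>

text \<open>The dynamic programming recursion, with the set \<open>S\<close> of revealed bits and their values read
  off from \<open>x\<close>. The third argument only serves the recursion; it is meant to be the number of
  bits outside \<open>S\<close>.\<close>

primrec budget_value ::
    "nat \<Rightarrow> ((nat \<Rightarrow> bool) \<Rightarrow> bool) \<Rightarrow> nat \<Rightarrow> nat set \<Rightarrow> (nat \<Rightarrow> bool) \<Rightarrow> real" where
  "budget_value n f 0 S x = 0"
| "budget_value n f (Suc m) S x =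
     (if determined n f S x then 0
      else Min ((\<lambda>i. 1 + (budget_value n f m (insert i S) (x(i := False)) +
                          budget_value n f m (insert i S) (x(i := True))) / 2) ` ({1..n} - S)))"

definition opt_value :: "nat \<Rightarrow> ((nat \<Rightarrow> bool) \<Rightarrow> bool) \<Rightarrow> nat set \<Rightarrow> (nat \<Rightarrow> bool) \<Rightarrow> real" where
  "opt_value n f S x = budget_value n f (n - card S) S x"

definition query_value ::
    "nat \<Rightarrow> ((nat \<Rightarrow> bool) \<Rightarrow> bool) \<Rightarrow> nat set \<Rightarrow> (nat \<Rightarrow> bool) \<Rightarrow> nat \<Rightarrow> real" where
  "query_value n f S x i =
     1 + (opt_value n f (insert i S) (x(i := False)) + opt_value n f (insert i S) (x(i := True))) / 2"

lemma determined_cong: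
  assumes "\<And>i. i \<in> S \<Longrightarrow> x i = x' i"
  shows "determined n f S x = determined n f S x'"
  using assms by (simp add: determined_def)

lemma determined_mono: "determined n f S x \<Longrightarrow> S \<subseteq> S' \<Longrightarrow> determined n f S' x"
  unfolding determined_def by (elim ex_forward) blast

lemma determined_all: "determined n f {1..n} x"
  unfolding determined_def
proof (intro exI ballI impI)
  fix y assume "y \<in> cube n" "\<forall>i\<in>{1..n}. y i = x i"
  then have "y = restrict x {1..n}"
    unfolding cube_def by (intro ext) (auto simp: PiE_def extensional_def)
  then show "f y = f (restrict x {1..n})" by simp
qed

lemma card_insert_complement:
  assumes "S \<subseteq> {1..n::nat}" "i \<in> {1..n} - S"
  shows "n - card S = Suc (n - card (insert i S))"
proof -
  have "finite S" using assms(1) finite_subset by blast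
  moreover have "card (insert i S) \<le> card {1..n}" using assms by (intro card_mono) auto
  ultimately show ?thesis using assms(2) by simp
qed

lemma opt_value_determined: "determined n f S x \<Longrightarrow> opt_value n f S x = 0"
  unfolding opt_value_def by (cases "n - card S") simp_all

lemma opt_value_undetermined:
  assumes S: "S \<subseteq> {1..n}" and nd: "\<not> determined n f S x"
  shows "{1..n} - S \<noteq> {}"
    and "opt_value n f S x = Min (query_value n f S x ` ({1..n} - S))"
proof -
  show ne: "{1..n} - S \<noteq> {}" using S nd determined_all[of n f x] by (metis Diff_eq_empty_iff subset_antisym)
  then obtain i where i: "i \<in> {1..n} - S" by blast
  define m where "m = n - card (insert i S)"
  have m: "n - card S = Suc m" unfolding m_def by (rule card_insert_complement[OF S i])
  have m': "n - card (insert j S) = m" if "j \<in> {1..n} - S" for j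
    using card_insert_complement[OF S that] m by simp
  have "query_value n f S x ` ({1..n} - S) =
      (\<lambda>i. 1 + (budget_value n f m (insert i S) (x(i := False)) +
                budget_value n f m (insert i S) (x(i := True))) / 2) ` ({1..n} - S)"
    by (intro image_cong refl) (simp add: query_value_def opt_value_def m')
  then show "opt_value n f S x = Min (query_value n f S x ` ({1..n} - S))"
    using nd by (simp add: opt_value_def m)
qed

text \<open>Backward induction on the revealed bits, in the direction in which values are computed.\<close>

lemma reveal_induct [consumes 1, case_names reveal]:
  assumes "S \<subseteq> {1..n::nat}"
    and "\<And>S x. S \<subseteq> {1..n} \<Longrightarrow> (\<And>i x'. i \<in> {1..n} - S \<Longrightarrow> P (insert i S) x') \<Longrightarrow> P S x"
  shows "P S x"
  using assms(1)
proof (induction "n - card S" arbitrary: S x rule: less_induct)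
  case less
  show ?case
  proof (rule assms(2)[OF less.prems])
    fix i x' assume i: "i \<in> {1..n} - S"
    have "n - card (insert i S) < n - card S"
      using card_insert_complement[OF less.prems i] by simp
    then show "P (insert i S) x'" using less i by auto
  qed
qed

lemma opt_value_attained:
  assumes "S \<subseteq> {1..n}" and "\<not> determined n f S x"
  obtains i where "i \<in> {1..n} - S" "opt_value n f S x = query_value n f S x i"
proof -
  have "Min (query_value n f S x ` ({1..n} - S)) \<in> query_value n f S x ` ({1..n} - S)"
    using opt_value_undetermined(1)[OF assms] by (intro Min_in) auto
  then show ?thesis using that opt_value_undetermined(2)[OF assms] by auto
qed

lemma opt_value_nonneg: "S \<subseteq> {1..n} \<Longrightarrow> 0 \<le> opt_value n f S x"
proof (induction S x rule: reveal_induct)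
  case (reveal S x)
  show ?case
  proof (cases "determined n f S x")
    case False
    obtain i where "i \<in> {1..n} - S" "opt_value n f S x = query_value n f S x i"
      using opt_value_attained[OF reveal.hyps False] .
    then show ?thesis using reveal.IH[of i] by (simp add: query_value_def)
  qed (simp add: opt_value_determined)
qed

lemma query_value_ge_1:
  assumes "S \<subseteq> {1..n}" "i \<in> {1..n}"
  shows "1 \<le> query_value n f S x i"
  using assms by (simp add: query_value_def opt_value_nonneg)

lemma opt_value_le_query_value:
  assumes "S \<subseteq> {1..n}" "i \<in> {1..n} - S"
  shows "opt_value n f S x \<le> query_value n f S x i"
proof (cases "determined n f S x")
  case True
  then show ?thesis using query_value_ge_1[of S n i f x] assms by (simp add: opt_value_determined)
next
  case False
  then show ?thesis using assms by (simp add: opt_value_undetermined(2))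
qed

lemma opt_value_le: "S \<subseteq> {1..n} \<Longrightarrow> opt_value n f S x \<le> real (n - card S)"
proof (induction S x rule: reveal_induct)
  case (reveal S x)
  show ?case
  proof (cases "determined n f S x")
    case False
    obtain i where i: "i \<in> {1..n} - S" "opt_value n f S x = query_value n f S x i"
      using opt_value_attained[OF reveal.hyps False] .
    have "opt_value n f (insert i S) (x(i := b)) \<le> real (n - card (insert i S))" for b
      by (rule reveal.IH[OF i(1)])
    from this[of False] this[of True] show ?thesis
      unfolding i(2) query_value_def card_insert_complement[OF reveal.hyps i(1)]
      by (simp del: fun_upd_apply)
  qed (simp add: opt_value_determined)
qed

text \<open>Each revealed bit contributes one halving, so with \<open>m\<close> bits left all values are multiples of
  \<open>2 ^ (- m)\<close>.\<close>

lemma query_value_dyadic: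
  assumes "S \<subseteq> {1..n}" "i \<in> {1..n} - S"
    and "\<And>x'. opt_value n f (insert i S) x' * 2 ^ (n - card (insert i S)) \<in> \<int>"
  shows "query_value n f S x i * 2 ^ (n - card S) \<in> \<int>"
proof -
  define m where "m = n - card (insert i S)"
  have "query_value n f S x i * 2 ^ (n - card S) =
      2 ^ Suc m + (opt_value n f (insert i S) (x(i := False)) * 2 ^ m +
                   opt_value n f (insert i S) (x(i := True)) * 2 ^ m)"
    unfolding card_insert_complement[OF assms(1,2)] query_value_def m_def[symmetric]
    by (simp add: field_simps)
  moreover have "(2::real) ^ Suc m \<in> \<int>" by (intro Ints_power) simp
  ultimately show ?thesis using assms(3) unfolding m_def by (metis Ints_add)
qed

lemma opt_value_dyadic: "S \<subseteq> {1..n} \<Longrightarrow> opt_value n f S x * 2 ^ (n - card S) \<in> \<int>"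
proof (induction S x rule: reveal_induct)
  case (reveal S x)
  show ?case
  proof (cases "determined n f S x")
    case False
    obtain i where i: "i \<in> {1..n} - S" "opt_value n f S x = query_value n f S x i"
      using opt_value_attained[OF reveal.hyps False] .
    then show ?thesis using query_value_dyadic[OF reveal.hyps i(1) reveal.IH[OF i(1)]] by simp
  qed (simp add: opt_value_determined)
qed

text \<open>Values are multiples of \<open>2 ^ (- m)\<close> with \<open>m\<close> bits left, and so a suboptimal query cannot be
  suboptimal by an arbitrarily small amount.\<close>

lemma regret_gap:
  assumes "S \<subseteq> {1..n}" "i \<in> {1..n} - S" "query_value n f S x i \<noteq> opt_value n f S x"
  shows "(1 / 2) ^ (n - card S) \<le> query_value n f S x i - opt_value n f S x"
proof -
  define r where "r = query_value n f S x i - opt_value n f S x"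
  have "r > 0" unfolding r_def using opt_value_le_query_value[OF assms(1,2)] assms(3)
    by (simp add: order_less_le)
  have "r * 2 ^ (n - card S) \<in> \<int>"
    unfolding r_def left_diff_distrib using assms
    by (intro Ints_diff query_value_dyadic opt_value_dyadic) auto
  moreover have "r * 2 ^ (n - card S) > 0" using \<open>r > 0\<close> by simp
  ultimately have "1 \<le> r * 2 ^ (n - card S)" by (auto elim!: Ints_cases)
  then show ?thesis unfolding r_def[symmetric] by (simp add: power_divide field_simps)
qed

lemma opt_value_cong:
  assumes "S \<subseteq> {1..n}" "\<And>i. i \<in> S \<Longrightarrow> x i = x' i"
  shows "opt_value n f S x = opt_value n f S x'"
  using assms
proof (induction S x arbitrary: x' rule: reveal_induct)
  case (reveal S x)
  have det: "determined n f S x = determined n f S x'"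
    using reveal.prems by (intro determined_cong) auto
  show ?case
  proof (cases "determined n f S x")
    case False
    have "query_value n f S x i = query_value n f S x' i" if "i \<in> {1..n} - S" for i
    proof -
      have "opt_value n f (insert i S) (x(i := b)) = opt_value n f (insert i S) (x'(i := b))" for b
        using reveal.prems by (intro reveal.IH[OF that]) auto
      then show ?thesis unfolding query_value_def by presburger
    qed
    then have "query_value n f S x ` ({1..n} - S) = query_value n f S x' ` ({1..n} - S)"
      by (intro image_cong) auto
    then show ?thesis using False det reveal.hyps by (simp add: opt_value_undetermined(2))
  qed (simp add: opt_value_determined det[symmetric])
qed

lemma query_value_cong:
  assumes "S \<subseteq> {1..n}" "i \<in> {1..n}" "\<And>j. j \<in> S \<Longrightarrow> x j = x' j"
  shows "query_value n f S x i = query_value n f S x' i"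
proof -
  have "opt_value n f (insert i S) (x(i := b)) = opt_value n f (insert i S) (x'(i := b))" for b
    using assms by (intro opt_value_cong) auto
  then show ?thesis unfolding query_value_def by presburger
qed

text \<open>The form of \<open>query_value\<close> that is adapted to pairing an outcome with the one in which bit \<open>i\<close>
  is flipped.\<close>

lemma query_value_flip:
  "query_value n f S x i =
     1 + (opt_value n f (insert i S) x + opt_value n f (insert i S) (x(i := \<not> x i))) / 2"
proof (cases "x i")
  case True
  then have "x(i := True) = x" by (intro ext) simp
  then show ?thesis using True by (simp add: query_value_def)
next
  case False
  then have "x(i := False) = x" by (intro ext) simp
  then show ?thesis using False by (simp add: query_value_def)
qed

text \<open>The exchange argument. If querying \<open>i\<close> is optimal, and then \<open>j\<close> is optimal for both
  values of bit \<open>i\<close>, then the pair of queries may be made in the other order at the same expected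
  cost. The value after \<open>j\<close> then has to be attained by querying \<open>i\<close>, for each of the two values of
  bit \<open>j\<close>: a strict inequality for one of them would give a total below the optimum.\<close>

lemma postpone_query:
  assumes S: "S \<subseteq> {1..n}" and i: "i \<in> {1..n} - S" and j: "j \<in> {1..n} - S" and ij: "i \<noteq> j"
    and opt_i: "query_value n f S x i = opt_value n f S x"
    and opt_j: "\<And>b. query_value n f (insert i S) (x(i := b)) j = opt_value n f (insert i S) (x(i := b))"
  shows "query_value n f (insert j S) x i = opt_value n f (insert j S) x"
proof -
  let ?V = "\<lambda>c. opt_value n f (insert j S) (x(j := c))"
  let ?U = "\<lambda>c. query_value n f (insert j S) (x(j := c)) i"
  have le: "?V c \<le> ?U c" for c using S i j ij by (intro opt_value_le_query_value) auto
  have "opt_value n f S x = query_value n f S x i" using opt_i by simp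
  also have "\<dots> = 1 + (query_value n f (insert i S) (x(i := False)) j +
                         query_value n f (insert i S) (x(i := True)) j) / 2"
    unfolding opt_j by (simp add: query_value_def)
  also have "\<dots> = 1 + (?U False + ?U True) / 2"
    using ij by (simp add: query_value_def insert_commute fun_upd_twist field_simps)
  finally have "opt_value n f S x = 1 + (?U False + ?U True) / 2" .
  moreover have "opt_value n f S x \<le> 1 + (?V False + ?V True) / 2"
    using opt_value_le_query_value[OF S j] by (simp add: query_value_def)
  ultimately have "?U False = ?V False" "?U True = ?V True" using le[of False] le[of True] by argo+
  then have "?U (x j) = ?V (x j)" by (cases "x j") simp_all
  then show ?thesis by simp
qed


section \<open>The finite sample space of the pairs of bits\<close>

definition outcomes :: "nat \<Rightarrow> (nat \<Rightarrow> bool \<times> bool) set" where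
  "outcomes n = {1..n} \<rightarrow>\<^sub>E UNIV"

definition bit_prob :: "real \<Rightarrow> bool \<times> bool \<Rightarrow> real" where
  "bit_prob p v = (if fst v = snd v then p / 2 else (1 - p) / 2)"

definition outcome_prob :: "nat \<Rightarrow> real \<Rightarrow> (nat \<Rightarrow> bool \<times> bool) \<Rightarrow> real" where
  "outcome_prob n p y = (\<Prod>i\<in>{1..n}. bit_prob p (y i))"

abbreviation hints :: "(nat \<Rightarrow> bool \<times> bool) \<Rightarrow> nat \<Rightarrow> bool" where "hints y \<equiv> \<lambda>i. fst (y i)"
abbreviation bits :: "(nat \<Rightarrow> bool \<times> bool) \<Rightarrow> nat \<Rightarrow> bool" where "bits y \<equiv> \<lambda>i. snd (y i)"

lemma finite_outcomes: "finite (outcomes n)"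
  unfolding outcomes_def by (intro finite_PiE) auto

lemma sum_outcome_prob_box:
  "(\<Sum>y\<in>PiE {1..n} B. outcome_prob n p y) = (\<Prod>i\<in>{1..n}. \<Sum>v\<in>B i. bit_prob p v)"
  unfolding outcome_prob_def by (intro prod_sum_PiE[symmetric]) auto

lemma UNIV_bool_pair: "(UNIV :: (bool \<times> bool) set) = {(True, True), (True, False), (False, True), (False, False)}"
  by auto

lemma sum_bit_prob: "(\<Sum>v\<in>UNIV. bit_prob p v) = 1"
  unfolding UNIV_bool_pair by (simp add: bit_prob_def field_simps)

lemma sum_bit_prob_snd: "(\<Sum>v\<in>{v. snd v = b}. bit_prob p v) = 1 / 2"
proof -
  have "{v. snd v = b} = {(True, b), (False, b)}" by auto
  then show ?thesis by (cases b) (simp_all add: bit_prob_def field_simps)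
qed

lemma outcome_prob_pos: "0 < p \<Longrightarrow> p < 1 \<Longrightarrow> 0 < outcome_prob n p y"
  unfolding outcome_prob_def by (intro prod_pos) (auto simp: bit_prob_def)

lemma sum_outcome_prob: "(\<Sum>y\<in>outcomes n. outcome_prob n p y) = 1"
  unfolding outcomes_def sum_outcome_prob_box sum_bit_prob by simp

text \<open>A coordinate that is fixed contributes the probability of one pair of bits, at least
  \<open>(1 - p) / 2\<close>; a free coordinate contributes \<open>1\<close>.\<close>

lemma outcome_prob_cylinder_ge:
  assumes "1 / 2 < p" "p < 1" "S \<subseteq> {1..n}" "y \<in> outcomes n"
  shows "((1 - p) / 2) ^ card S \<le> (\<Sum>y'\<in>{y'\<in>outcomes n. \<forall>i\<in>S. y' i = y i}. outcome_prob n p y')"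
proof -
  define B where "B i = (if i \<in> S then {y i} else UNIV)" for i
  have box: "{y'\<in>outcomes n. \<forall>i\<in>S. y' i = y i} = PiE {1..n} B"
    using assms(3) unfolding outcomes_def B_def PiE_def Pi_def by (auto split: if_splits)
  have "((1 - p) / 2) ^ card S = (\<Prod>i\<in>{1..n}. if i \<in> S then (1 - p) / 2 else 1)"
  proof -
    have "{1..n} \<inter> S = S" using assms(3) by auto
    then show ?thesis by (simp add: prod.If_cases)
  qed
  also have "\<dots> \<le> (\<Prod>i\<in>{1..n}. \<Sum>v\<in>B i. bit_prob p v)"
  proof (intro prod_mono conjI)
    fix i
    show "(if i \<in> S then (1 - p) / 2 else 1) \<le> (\<Sum>v\<in>B i. bit_prob p v)"
      using assms(1) by (simp add: B_def sum_bit_prob) (simp add: bit_prob_def)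
  qed (use assms(2) in auto)
  finally show ?thesis unfolding box sum_outcome_prob_box .
qed

text \<open>The bits of a random outcome are uniformly distributed on the cube.\<close>

lemma sum_outcome_prob_bits:
  "(\<Sum>y\<in>outcomes n. outcome_prob n p y * g (restrict (bits y) {1..n})) =
     measure_pmf.expectation (pmf_of_set (cube n)) g"
proof -
  have fin: "finite (cube n)" unfolding cube_def by (intro finite_PiE) auto
  have card: "card (cube n) = 2 ^ n" unfolding cube_def by (simp add: card_PiE)
  have ne: "cube n \<noteq> {}" using card by (metis card.empty power_not_zero zero_neq_numeral)
  have maps: "(\<lambda>y. restrict (bits y) {1..n}) ` outcomes n \<subseteq> cube n"
    unfolding outcomes_def cube_def by auto
  have fiber: "(\<Sum>y\<in>{y\<in>outcomes n. restrict (bits y) {1..n} = x}. outcome_prob n p y) = (1 / 2) ^ n"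
    if x: "x \<in> cube n" for x
  proof -
    have "{y\<in>outcomes n. restrict (bits y) {1..n} = x} = PiE {1..n} (\<lambda>i. {v. snd v = x i})"
    proof (intro set_eqI iffI)
      fix y :: "nat \<Rightarrow> bool \<times> bool" assume "y \<in> {y\<in>outcomes n. restrict (bits y) {1..n} = x}"
      then show "y \<in> PiE {1..n} (\<lambda>i. {v. snd v = x i})"
        unfolding outcomes_def by (auto simp: PiE_iff)
    next
      fix y :: "nat \<Rightarrow> bool \<times> bool" assume y: "y \<in> PiE {1..n} (\<lambda>i. {v. snd v = x i})"
      have "restrict (bits y) {1..n} = x"
        using x y unfolding cube_def by (intro ext) (auto simp: PiE_iff extensional_def restrict_def)
      then show "y \<in> {y\<in>outcomes n. restrict (bits y) {1..n} = x}"
        using y unfolding outcomes_def by (auto simp: PiE_iff)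
    qed
    then show ?thesis by (simp only: sum_outcome_prob_box sum_bit_prob_snd) simp
  qed
  have "(\<Sum>y\<in>outcomes n. outcome_prob n p y * g (restrict (bits y) {1..n})) =
      (\<Sum>x\<in>cube n. \<Sum>y\<in>{y\<in>outcomes n. restrict (bits y) {1..n} = x}.
         outcome_prob n p y * g (restrict (bits y) {1..n}))"
    by (rule sum.group[OF finite_outcomes fin maps, symmetric])
  also have "\<dots> = (\<Sum>x\<in>cube n. (1 / 2) ^ n * g x)"
  proof (intro sum.cong refl)
    fix x assume "x \<in> cube n"
    show "(\<Sum>y\<in>{y\<in>outcomes n. restrict (bits y) {1..n} = x}.
         outcome_prob n p y * g (restrict (bits y) {1..n})) = (1 / 2) ^ n * g x"
      unfolding fiber[OF \<open>x \<in> cube n\<close>, symmetric] sum_distrib_right by (intro sum.cong) auto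
  qed
  also have "\<dots> = measure_pmf.expectation (pmf_of_set (cube n)) g"
    by (simp add: integral_pmf_of_set[OF ne fin] card sum_divide_distrib power_divide)
  finally show ?thesis .
qed

section \<open>Accounting for the queries of an algorithm with partial information\<close>

lemma stop_time_properties:
  assumes "st2 (A (2 * n) \<omega>) = {1..n}"
  shows "stop_time n f X A \<omega> \<le> 2 * n"
    and "determined n f (st2 (A (stop_time n f X A \<omega>) \<omega>)) (\<lambda>i. X i \<omega>)"
    and "t < stop_time n f X A \<omega> \<longleftrightarrow> (\<forall>s\<le>t. \<not> determined n f (st2 (A s \<omega>)) (\<lambda>i. X i \<omega>))"
proof -
  define P where "P s \<longleftrightarrow> determined n f (st2 (A s \<omega>)) (\<lambda>i. X i \<omega>)" for s
  have T: "stop_time n f X A \<omega> = (LEAST s. P s)" by (simp add: stop_time_def P_def)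
  have D: "P (2 * n)" unfolding P_def assms by (rule determined_all)
  show "stop_time n f X A \<omega> \<le> 2 * n" unfolding T using D by (rule Least_le)
  have det: "P (stop_time n f X A \<omega>)" unfolding T using D by (rule LeastI)
  then show "determined n f (st2 (A (stop_time n f X A \<omega>) \<omega>)) (\<lambda>i. X i \<omega>)" by (simp add: P_def)
  have "t < stop_time n f X A \<omega> \<longleftrightarrow> (\<forall>s\<le>t. \<not> P s)"
  proof
    assume "t < stop_time n f X A \<omega>"
    then show "\<forall>s\<le>t. \<not> P s" unfolding T by (intro allI impI not_less_Least) (rule le_less_trans)
  next
    assume "\<forall>s\<le>t. \<not> P s"
    then show "t < stop_time n f X A \<omega>" using det by (meson not_less)
  qed
  then show "t < stop_time n f X A \<omega> \<longleftrightarrow> (\<forall>s\<le>t. \<not> determined n f (st2 (A s \<omega>)) (\<lambda>i. X i \<omega>))"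
    by (simp add: P_def)
qed

text \<open>An algorithm whose sample points are the outcomes of the pairs themselves. The set
  \<open>seen t y\<close> consists of the bits revealed by the accelerated algorithm that reads \<open>X i\<close> as soon as
  \<open>Z i\<close> is queried, so it grows exactly when a hint is queried, and it stays the same when a bit is
  queried.\<close>

locale canonical_algorithm =
  fixes n :: nat and f :: "(nat \<Rightarrow> bool) \<Rightarrow> bool" and p :: real
    and A :: "nat \<Rightarrow> (nat \<Rightarrow> bool \<times> bool) \<Rightarrow> state"
  assumes p: "1 / 2 < p" "p < 1"
    and algorithm: "A \<in> partial_algorithms (count_space (outcomes n)) n (\<lambda>i y. fst (y i)) (\<lambda>i y. snd (y i))"
begin

abbreviation stop :: "(nat \<Rightarrow> bool \<times> bool) \<Rightarrow> nat" where
  "stop \<equiv> stop_time n f (\<lambda>i y. snd (y i)) A"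

definition seen :: "nat \<Rightarrow> (nat \<Rightarrow> bool \<times> bool) \<Rightarrow> nat set" where
  "seen t y = st1 (A t y) \<union> st2 (A t y)"

definition asks :: "nat \<Rightarrow> (nat \<Rightarrow> bool \<times> bool) \<Rightarrow> bool" where
  "asks t y \<longleftrightarrow> t < stop y \<and> seen (Suc t) y \<noteq> seen t y"

definition asked :: "nat \<Rightarrow> (nat \<Rightarrow> bool \<times> bool) \<Rightarrow> nat" where
  "asked t y = the_elem (seen (Suc t) y - seen t y)"

definition regret :: "nat \<Rightarrow> (nat \<Rightarrow> bool \<times> bool) \<Rightarrow> real" where
  "regret t y =
     (if asks t y
      then query_value n f (seen t y) (bits y) (asked t y) - opt_value n f (seen t y) (bits y) else 0)"

definition potential :: "nat \<Rightarrow> (nat \<Rightarrow> bool \<times> bool) \<Rightarrow> real" where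
  "potential t y = real (card (seen t y)) + opt_value n f (seen t y) (bits y)"

definition drift :: "nat \<Rightarrow> (nat \<Rightarrow> bool \<times> bool) \<Rightarrow> real" where
  "drift t y = (if t < stop y then potential (Suc t) y - potential t y else 0)"

lemma start: "y \<in> outcomes n \<Longrightarrow> A 0 y = ({1..n}, {}, {})"
  and finish: "y \<in> outcomes n \<Longrightarrow> A (2 * n) y = ({}, {}, {1..n})"
  and partition: "y \<in> outcomes n \<Longrightarrow> t \<le> 2 * n \<Longrightarrow> ordered_partition n (A t y)"
  and step: "y \<in> outcomes n \<Longrightarrow> t < 2 * n \<Longrightarrow> query_step (A t y) (A (Suc t) y)"
  using conjunct1[OF algorithm[unfolded partial_algorithms_def mem_Collect_eq space_count_space]] by auto

lemma same_next: "y \<in> outcomes n \<Longrightarrow> y' \<in> outcomes n \<Longrightarrow> t < 2 * n \<Longrightarrow> A t y = A t y' \<Longrightarrow>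
     (\<And>i. i \<in> st1 (A t y) \<Longrightarrow> fst (y i) = fst (y' i)) \<Longrightarrow>
     (\<And>i. i \<in> st2 (A t y) \<Longrightarrow> snd (y i) = snd (y' i)) \<Longrightarrow> A (Suc t) y = A (Suc t) y'"
  using conjunct2[OF algorithm[unfolded partial_algorithms_def mem_Collect_eq space_count_space]] by blast

lemma stop_le: "y \<in> outcomes n \<Longrightarrow> stop y \<le> 2 * n"
  by (intro stop_time_properties(1)) (simp add: finish)

lemma determined_stop: "y \<in> outcomes n \<Longrightarrow> determined n f (st2 (A (stop y) y)) (bits y)"
  using stop_time_properties(2)[of A n y f "\<lambda>i y. snd (y i)"] by (simp add: finish)

lemma less_stop_iff:
  "y \<in> outcomes n \<Longrightarrow> t < stop y \<longleftrightarrow> (\<forall>s\<le>t. \<not> determined n f (st2 (A s y)) (bits y))"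
  using stop_time_properties(3)[of A n y t f "\<lambda>i y. snd (y i)"] by (simp add: finish)

lemma seen_subset: "y \<in> outcomes n \<Longrightarrow> t \<le> 2 * n \<Longrightarrow> seen t y \<subseteq> {1..n}"
  using partition[of y t] by (auto simp: ordered_partition_def seen_def)

lemma card_seen:
  assumes "y \<in> outcomes n" "t \<le> 2 * n"
  shows "card (seen t y) = card (st1 (A t y)) + card (st2 (A t y))"
  unfolding seen_def
proof (intro card_Un_disjoint)
  show "finite (st1 (A t y))" "finite (st2 (A t y))"
    using seen_subset[OF assms] finite_subset[of _ "{1..n}"] unfolding seen_def by auto
  show "st1 (A t y) \<inter> st2 (A t y) = {}"
    using partition[OF assms] by (simp add: ordered_partition_def)
qed

lemma step_cases:
  assumes "y \<in> outcomes n" "t < 2 * n"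
  obtains (hint) i where "i \<in> {1..n}" "i \<notin> seen t y" "st1 (A (Suc t) y) = insert i (st1 (A t y))"
      "st2 (A (Suc t) y) = st2 (A t y)" "seen (Suc t) y = insert i (seen t y)"
    | (bit) i where "i \<in> st1 (A t y)" "st1 (A (Suc t) y) = st1 (A t y) - {i}"
      "st2 (A (Suc t) y) = insert i (st2 (A t y))" "seen (Suc t) y = seen t y"
proof -
  have part: "ordered_partition n (A t y)" using partition assms by simp
  consider i where "i \<in> st0 (A t y)" "A (Suc t) y = (st0 (A t y) - {i}, insert i (st1 (A t y)), st2 (A t y))"
    | i where "i \<in> st1 (A t y)" "A (Suc t) y = (st0 (A t y), st1 (A t y) - {i}, insert i (st2 (A t y)))"
    using step[OF assms] unfolding query_step_def by blast
  then show ?thesis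
  proof cases
    case 1
    then have "i \<in> {1..n}" "i \<notin> seen t y" using part by (auto simp: ordered_partition_def seen_def)
    then show ?thesis using hint[of i] 1 by (auto simp: seen_def)
  next
    case 2
    then show ?thesis using bit[of i] by (auto simp: seen_def)
  qed
qed

lemma asks_cases:
  assumes "y \<in> outcomes n" "asks t y"
  shows "t < 2 * n" "asked t y \<in> {1..n} - seen t y" "seen (Suc t) y = insert (asked t y) (seen t y)"
proof -
  show t: "t < 2 * n" using assms stop_le[OF assms(1)] by (simp add: asks_def)
  obtain i where i: "i \<in> {1..n}" "i \<notin> seen t y" "seen (Suc t) y = insert i (seen t y)"
    using step_cases[OF assms(1) t] assms(2) unfolding asks_def by metis
  have "seen (Suc t) y - seen t y = {i}" using i by auto
  then have "asked t y = i" by (simp add: asked_def)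
  then show "asked t y \<in> {1..n} - seen t y" "seen (Suc t) y = insert (asked t y) (seen t y)" using i by auto
qed

lemma mono_states:
  assumes "y \<in> outcomes n" "s \<le> t" "t \<le> 2 * n"
  shows "seen s y \<subseteq> seen t y" "st2 (A s y) \<subseteq> st2 (A t y)"
proof -
  have "seen s y \<subseteq> seen t y \<and> st2 (A s y) \<subseteq> st2 (A t y)"
    using assms(2,3)
  proof (induction t rule: dec_induct)
    case (step t)
    then have "t < 2 * n" by simp
    then have "seen t y \<subseteq> seen (Suc t) y \<and> st2 (A t y) \<subseteq> st2 (A (Suc t) y)"
      using step_cases[OF assms(1), of t] by (metis subset_insertI subset_refl)
    then show ?case using step by auto
  qed simp
  then show "seen s y \<subseteq> seen t y" "st2 (A s y) \<subseteq> st2 (A t y)" by auto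
qed

text \<open>By induction on time, the path of the algorithm is a function of the answers it has received.
  The hypotheses ask for agreement only on what has been queried before time \<open>t\<close>, so a bit may
  change while its hint is kept; this is what \<open>wasted_hint_regret\<close> relies on.\<close>

lemma same_states:
  assumes "y \<in> outcomes n" "y' \<in> outcomes n" "t \<le> 2 * n"
    and "\<And>s i. s < t \<Longrightarrow> i \<in> st1 (A s y) \<Longrightarrow> fst (y i) = fst (y' i)"
    and "\<And>s i. s < t \<Longrightarrow> i \<in> st2 (A s y) \<Longrightarrow> snd (y i) = snd (y' i)"
  shows "A t y' = A t y"
  using assms(3-)
proof (induction t)
  case 0
  then show ?case using assms(1,2) by (simp add: start)
next
  case (Suc t)
  then have "A t y' = A t y" by (meson Suc_leD less_SucI)
  then show ?case using same_next[OF assms(1,2), of t] Suc.prems by (metis Suc_le_lessD lessI)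
qed

lemma same_states_seen:
  assumes "y \<in> outcomes n" "y' \<in> outcomes n" "t < 2 * n" "\<And>i. i \<in> seen t y \<Longrightarrow> y' i = y i" "s \<le> Suc t"
  shows "A s y' = A s y"
proof (intro same_states)
  fix r i assume r: "r < s"
  then have "seen r y \<subseteq> seen t y" using assms by (intro mono_states) auto
  then have "i \<in> st1 (A r y) \<or> i \<in> st2 (A r y) \<Longrightarrow> y' i = y i" using assms(4) by (auto simp: seen_def)
  then show "i \<in> st1 (A r y) \<Longrightarrow> fst (y i) = fst (y' i)" "i \<in> st2 (A r y) \<Longrightarrow> snd (y i) = snd (y' i)"
    by auto
qed (use assms in auto)

lemma same_asks:
  assumes "y \<in> outcomes n" "y' \<in> outcomes n" "t < 2 * n" "\<And>i. i \<in> seen t y \<Longrightarrow> y' i = y i"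
  shows "seen t y' = seen t y" "seen (Suc t) y' = seen (Suc t) y" "asked t y' = asked t y"
    "t < stop y' \<longleftrightarrow> t < stop y" "asks t y' = asks t y"
proof -
  have same: "A s y' = A s y" if "s \<le> Suc t" for s using same_states_seen[OF assms that] .
  show seen: "seen t y' = seen t y" "seen (Suc t) y' = seen (Suc t) y" using same by (simp_all add: seen_def)
  show "asked t y' = asked t y" by (simp add: asked_def seen)
  have "determined n f (st2 (A s y')) (bits y') = determined n f (st2 (A s y)) (bits y)" if "s \<le> t" for s
  proof -
    have "st2 (A s y) \<subseteq> seen t y" using mono_states(1)[OF assms(1) that] assms(3) by (auto simp: seen_def)
    then show ?thesis using same[of s] that assms(4) by (simp, intro determined_cong) auto
  qed
  then show "t < stop y' \<longleftrightarrow> t < stop y" by (simp add: less_stop_iff assms)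
  then show "asks t y' = asks t y" by (simp add: asks_def seen)
qed

lemma regret_cong:
  assumes "y \<in> outcomes n" "y' \<in> outcomes n" "t < 2 * n" "\<And>i. i \<in> seen t y \<Longrightarrow> y' i = y i"
  shows "regret t y' = regret t y"
proof (cases "asks t y")
  case True
  note q = asks_cases[OF assms(1) True]
  have "opt_value n f (seen t y) (bits y') = opt_value n f (seen t y) (bits y)"
    using seen_subset[OF assms(1), of t] assms(3,4) by (intro opt_value_cong) auto
  moreover have "query_value n f (seen t y) (bits y') (asked t y) = query_value n f (seen t y) (bits y) (asked t y)"
    using seen_subset[OF assms(1), of t] assms(3,4) q by (intro query_value_cong) auto
  ultimately show ?thesis using same_asks[OF assms] by (simp add: regret_def)
next
  case False
  then show ?thesis using same_asks[OF assms] by (simp add: regret_def)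
qed

lemma regret_nonneg: "y \<in> outcomes n \<Longrightarrow> 0 \<le> regret t y"
  using opt_value_le_query_value[OF seen_subset asks_cases(2)] asks_cases(1)
  by (fastforce simp: regret_def)

text \<open>Flipping both \<open>Z i\<close> and \<open>X i\<close>, for the coordinate \<open>i\<close> that is about to be queried, preserves
  the probability and all that was seen before. The bit \<open>X i\<close> takes both values on such a pair of
  outcomes, so the average of the drift over the pair is the regret of querying \<open>i\<close>.\<close>

lemma drift_paired:
  assumes "y \<in> outcomes n" "asks t y"
  defines "y' \<equiv> y(asked t y := (\<not> fst (y (asked t y)), \<not> snd (y (asked t y))))"
  shows "y' \<in> outcomes n" "asks t y'" "asked t y' = asked t y"
    "outcome_prob n p y' = outcome_prob n p y" "drift t y + drift t y' = 2 * regret t y"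
proof -
  let ?i = "asked t y"
  note q = asks_cases[OF assms(1,2)]
  show out: "y' \<in> outcomes n" using assms(1) q(2) unfolding y'_def outcomes_def by (auto simp: PiE_iff extensional_def)
  have agree: "\<And>i. i \<in> seen t y \<Longrightarrow> y' i = y i" using q(2) by (auto simp: y'_def)
  note same = same_asks[OF assms(1) out q(1) agree]
  show "asks t y'" "asked t y' = asked t y" using same assms(2) by auto
  show "outcome_prob n p y' = outcome_prob n p y"
    unfolding outcome_prob_def by (intro prod.cong) (auto simp: y'_def bit_prob_def)
  have bits: "bits y' = (bits y)(?i := \<not> bits y ?i)" by (auto simp: y'_def)
  have sub: "seen t y \<subseteq> {1..n}" using seen_subset[OF assms(1)] q(1) by simp
  have V: "opt_value n f (seen t y) (bits y') = opt_value n f (seen t y) (bits y)"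
    using sub agree by (intro opt_value_cong) auto
  have card: "card (insert ?i (seen t y)) = Suc (card (seen t y))"
    using q(2) sub finite_subset by (intro card_insert_disjoint) auto
  have stop: "t < stop y" "t < stop y'" using assms(2) same(4) by (auto simp: asks_def)
  have "drift t y + drift t y' =
      2 + opt_value n f (insert ?i (seen t y)) (bits y) + opt_value n f (insert ?i (seen t y)) (bits y')
        - 2 * opt_value n f (seen t y) (bits y)"
    using stop by (simp add: drift_def potential_def same V q(3) card)
  also have "\<dots> = 2 * regret t y"
    using assms(2) unfolding regret_def query_value_flip bits by (simp add: field_simps)
  finally show "drift t y + drift t y' = 2 * regret t y" .
qed

text \<open>The pairing of outcomes is an involution for each fixed time, which makes the drift and the
  regret have the same expectation. This replaces conditioning on the past.\<close>

lemma expected_drift: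
  "(\<Sum>y\<in>outcomes n. outcome_prob n p y * drift t y) = (\<Sum>y\<in>outcomes n. outcome_prob n p y * regret t y)"
proof -
  define flip where "flip y =
    (if asks t y then y(asked t y := (\<not> fst (y (asked t y)), \<not> snd (y (asked t y)))) else y)" for y
  have flip_out: "flip y \<in> outcomes n" and flip_flip: "flip (flip y) = y"
    and flip_prob: "outcome_prob n p (flip y) = outcome_prob n p y"
    and flip_drift: "drift t y + drift t (flip y) = 2 * regret t y" if y: "y \<in> outcomes n" for y
  proof -
    note paired = drift_paired[OF y, of t]
    have "drift t y = 0" if "\<not> asks t y"
      using that by (auto simp: drift_def asks_def potential_def)
    then show "flip y \<in> outcomes n" "flip (flip y) = y" "outcome_prob n p (flip y) = outcome_prob n p y"
      "drift t y + drift t (flip y) = 2 * regret t y"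
      using paired y by (auto simp: flip_def regret_def)
  qed
  have "(\<Sum>y\<in>outcomes n. outcome_prob n p y * drift t y) =
      (\<Sum>y\<in>outcomes n. outcome_prob n p y * drift t (flip y))"
    by (rule sum.reindex_bij_witness[where i = flip and j = flip])
      (auto simp: flip_out flip_flip flip_prob)
  then have "2 * (\<Sum>y\<in>outcomes n. outcome_prob n p y * drift t y) =
      (\<Sum>y\<in>outcomes n. outcome_prob n p y * (drift t y + drift t (flip y)))"
    by (simp add: distrib_left sum.distrib)
  also have "\<dots> = 2 * (\<Sum>y\<in>outcomes n. outcome_prob n p y * regret t y)"
    unfolding sum_distrib_left by (intro sum.cong refl) (simp add: flip_drift)
  finally show ?thesis by simp
qed

lemma sum_drift:
  assumes y: "y \<in> outcomes n"
  shows "(\<Sum>t<2 * n. drift t y) = real (card (seen (stop y) y)) - opt_value n f {} x"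
proof -
  have "determined n f (seen (stop y) y) (bits y)"
    by (rule determined_mono[OF determined_stop[OF y]]) (simp add: seen_def)
  then have last: "potential (stop y) y = real (card (seen (stop y) y))"
    by (simp add: potential_def opt_value_determined)
  have "(\<Sum>t<2 * n. drift t y) = (\<Sum>t<stop y. potential (Suc t) y - potential t y)"
    using stop_le[OF y] by (intro sum.mono_neutral_cong_right) (auto simp: drift_def)
  also have "\<dots> = potential (stop y) y - potential 0 y" by (rule sum_lessThan_telescope)
  also have "potential 0 y = opt_value n f {} x"
    using opt_value_cong[of "{}" n "bits y" x f] by (simp add: potential_def seen_def start[OF y])
  finally show ?thesis unfolding last .
qed

definition total_regret :: real where
  "total_regret = (\<Sum>y\<in>outcomes n. outcome_prob n p y * (\<Sum>t<2 * n. regret t y))"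

text \<open>The potential starts at \<open>opt_value n f {}\<close> and ends at the number of bits seen, as nothing
  remains to be paid once \<open>f\<close> is determined. Its expected increments are the expected regrets.\<close>

lemma expected_seen:
  "(\<Sum>y\<in>outcomes n. outcome_prob n p y * real (card (seen (stop y) y))) =
     opt_value n f {} x + total_regret"
proof -
  have "(\<Sum>y\<in>outcomes n. outcome_prob n p y * (\<Sum>t<2 * n. drift t y)) = total_regret"
    unfolding total_regret_def sum_distrib_left
    by (subst (1 2) sum.swap) (simp add: expected_drift)
  moreover have "(\<Sum>y\<in>outcomes n. outcome_prob n p y * (\<Sum>t<2 * n. drift t y)) =
      (\<Sum>y\<in>outcomes n. outcome_prob n p y * real (card (seen (stop y) y))) -
      (\<Sum>y\<in>outcomes n. outcome_prob n p y) * opt_value n f {} x"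
    unfolding sum_distrib_right sum_subtractf[symmetric]
    by (intro sum.cong refl) (simp add: sum_drift[of _ x] right_diff_distrib)
  ultimately show ?thesis by (simp add: sum_outcome_prob)
qed

lemma weighted_regret_nonneg:
  "y \<in> outcomes n \<Longrightarrow> 0 \<le> outcome_prob n p y * (\<Sum>t<2 * n. regret t y)"
  using p outcome_prob_pos[of p n y]
  by (intro mult_nonneg_nonneg sum_nonneg regret_nonneg) auto

lemma total_regret_nonneg: "0 \<le> total_regret"
  unfolding total_regret_def by (intro sum_nonneg weighted_regret_nonneg)

text \<open>The regret is the same for all outcomes that agree with \<open>y\<close> on the \<open>k\<close> coordinates seen at
  time \<open>t\<close>. They have probability at least \<open>((1 - p) / 2) ^ k\<close>, and the regret is at least
  \<open>(1 / 2) ^ (n - k)\<close>, which is at least \<open>((1 - p) / 2) ^ (n - k)\<close>.\<close>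

lemma total_regret_ge:
  assumes y: "y \<in> outcomes n" and pos: "regret t y \<noteq> 0"
  shows "((1 - p) / 2) ^ n \<le> total_regret"
proof -
  have asks: "asks t y" using pos by (auto simp: regret_def split: if_splits)
  note q = asks_cases[OF y asks]
  have sub: "seen t y \<subseteq> {1..n}" using seen_subset[OF y] q(1) by simp
  define C where "C = {y'\<in>outcomes n. \<forall>i\<in>seen t y. y' i = y i}"
  have gap: "(1 / 2) ^ (n - card (seen t y)) \<le> regret t y"
    using regret_gap[OF sub q(2)] pos asks by (simp add: regret_def)
  have le: "card (seen t y) \<le> n" using card_mono[OF _ sub] by simp
  have "((1 - p) / 2) ^ n = ((1 - p) / 2) ^ card (seen t y) * ((1 - p) / 2) ^ (n - card (seen t y))"
    using le by (simp flip: power_add)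
  also have "\<dots> \<le> ((1 - p) / 2) ^ card (seen t y) * regret t y"
    using p order_trans[OF power_mono gap, of "(1 - p) / 2"] by (intro mult_left_mono) auto
  also have "\<dots> \<le> (\<Sum>y'\<in>C. outcome_prob n p y') * regret t y"
    unfolding C_def using p y sub regret_nonneg[OF y]
    by (intro mult_right_mono outcome_prob_cylinder_ge) auto
  also have "\<dots> = (\<Sum>y'\<in>C. outcome_prob n p y' * regret t y')"
    unfolding sum_distrib_right
    by (intro sum.cong refl) (auto simp: C_def intro!: arg_cong2[where f = "(*)"] regret_cong[OF y _ q(1), symmetric])
  also have "\<dots> \<le> (\<Sum>y'\<in>C. outcome_prob n p y' * (\<Sum>t<2 * n. regret t y'))"
  proof (intro sum_mono mult_left_mono)
    fix y' assume "y' \<in> C"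
    then show "regret t y' \<le> (\<Sum>t<2 * n. regret t y')"
      using q(1) regret_nonneg by (intro member_le_sum) (auto simp: C_def)
  qed (use p outcome_prob_pos[of p n] in \<open>auto intro: less_imp_le\<close>)
  also have "\<dots> \<le> total_regret"
    unfolding total_regret_def C_def by (intro sum_mono2 finite_outcomes weighted_regret_nonneg) auto
  finally show ?thesis .
qed

text \<open>If there were no regret at all, then for a coordinate \<open>i\<close> whose hint is pending at the end the
  query of \<open>i\<close> could be postponed, one query at a time, until \<open>f\<close> is determined by the other bits.
  There it still costs \<open>1\<close>, whereas the optimal remaining cost is \<open>0\<close>.\<close>

lemma wasted_hint_regret:
  assumes y: "y \<in> outcomes n" and wasted: "st1 (A (stop y) y) \<noteq> {}"
  shows "\<exists>t y'. y' \<in> outcomes n \<and> regret t y' \<noteq> 0"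
proof (rule ccontr)
  assume no_regret: "\<not> ?thesis"
  have optimal: "query_value n f (seen t y') (bits y') (asked t y') = opt_value n f (seen t y') (bits y')"
    if "y' \<in> outcomes n" "asks t y'" for t y'
  proof -
    have "regret t y' = 0" using no_regret that(1) by blast
    then show ?thesis using that(2) by (simp add: regret_def)
  qed
  obtain i where i: "i \<in> st1 (A (stop y) y)" using wasted by blast
  have iI: "i \<in> {1..n}" using i seen_subset[OF y stop_le[OF y]] by (auto simp: seen_def)
  have i2: "i \<notin> st2 (A t y)" if "t \<le> stop y" for t
    using i mono_states(2)[OF y that stop_le[OF y]] partition[OF y stop_le[OF y]]
    by (auto simp: ordered_partition_def)
  \<comment> \<open>Changing \<open>X i\<close> alone has no influence on the path up to the stopping time, so each query on
    the path is made, and is optimal, for both values of \<open>X i\<close>.\<close>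
  have variant: "\<exists>y'\<in>outcomes n. bits y' = (bits y)(i := b) \<and> (\<forall>t<stop y. seen t y' = seen t y \<and>
      asks t y' = asks t y \<and> asked t y' = asked t y)" for b
  proof -
    define y' where "y' = y(i := (fst (y i), b))"
    have out: "y' \<in> outcomes n" using y iI unfolding y'_def outcomes_def by (auto simp: PiE_iff extensional_def)
    have same: "A t y' = A t y" if "t \<le> stop y" for t
    proof (rule same_states[OF y out])
      show "t \<le> 2 * n" using that stop_le[OF y] by simp
      fix s j assume "s < t"
      then show "fst (y j) = fst (y' j)" "j \<in> st2 (A s y) \<Longrightarrow> snd (y j) = snd (y' j)"
        using i2[of s] that by (auto simp: y'_def)
    qed
    have "stop y' > t" if "t < stop y" for t
    proof -
      have "determined n f (st2 (A s y')) (bits y') = determined n f (st2 (A s y)) (bits y)" if "s \<le> t" for s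
      proof -
        have "s \<le> stop y" using that \<open>t < stop y\<close> by simp
        then show ?thesis unfolding same[OF \<open>s \<le> stop y\<close>] using i2
          by (intro determined_cong) (auto simp: y'_def)
      qed
      then show ?thesis using that by (simp add: less_stop_iff y out)
    qed
    then have "\<forall>t<stop y. seen t y' = seen t y \<and> asks t y' = asks t y \<and> asked t y' = asked t y"
      by (simp add: asks_def asked_def seen_def same Suc_leI)
    moreover have "bits y' = (bits y)(i := b)" by (auto simp: y'_def)
    ultimately show ?thesis using out by blast
  qed
  \<comment> \<open>The query of \<open>i\<close> stays optimal when \<open>i\<close> is taken out of the bits seen at time \<open>t\<close>.\<close>
  have postponed: "query_value n f (seen t y - {i}) (bits y) i = opt_value n f (seen t y - {i}) (bits y)"
    if "t \<le> stop y" "i \<in> seen t y" for t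
    using that
  proof (induction t)
    case 0
    then show ?case by (simp add: seen_def start[OF y])
  next
    case (Suc t)
    have t: "t < stop y" "t < 2 * n" using Suc.prems stop_le[OF y] by auto
    show ?case
    proof (cases "asks t y")
      case False
      then show ?thesis using Suc t by (simp add: asks_def)
    next
      case True
      note q = asks_cases[OF y True]
      have sub: "seen t y \<subseteq> {1..n}" using seen_subset[OF y] t by simp
      show ?thesis
      proof (cases "i \<in> seen t y")
        case False
        then have "asked t y = i" "seen (Suc t) y - {i} = seen t y" using Suc.prems(2) q by auto
        then show ?thesis using optimal[OF y True] by simp
      next
        case i_seen: True
        define R where "R = seen t y - {i}"
        have R: "insert i R = seen t y" "seen (Suc t) y - {i} = insert (asked t y) R"
          using i_seen q by (auto simp: R_def)
        have "query_value n f (insert (asked t y) R) (bits y) i = opt_value n f (insert (asked t y) R) (bits y)"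
        proof (rule postpone_query)
          show "R \<subseteq> {1..n}" "i \<in> {1..n} - R" "asked t y \<in> {1..n} - R" "i \<noteq> asked t y"
            using sub iI q(2) i_seen by (auto simp: R_def)
          show "query_value n f R (bits y) i = opt_value n f R (bits y)"
            using Suc.IH t i_seen by (simp add: R_def)
          fix b
          obtain y' where "y' \<in> outcomes n" "bits y' = (bits y)(i := b)" "seen t y' = seen t y"
            "asks t y'" "asked t y' = asked t y"
            using variant[of b] t(1) True by blast
          then show "query_value n f (insert i R) ((bits y)(i := b)) (asked t y) =
              opt_value n f (insert i R) ((bits y)(i := b))"
            using optimal[of y' t] by (simp add: R)
        qed
        then show ?thesis by (simp add: R)
      qed
    qed
  qed
  let ?S = "seen (stop y) y - {i}"
  have "st2 (A (stop y) y) \<subseteq> ?S" using i2[of "stop y"] by (auto simp: seen_def)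
  then have "opt_value n f ?S (bits y) = 0"
    by (intro opt_value_determined determined_mono[OF determined_stop[OF y]])
  moreover have "1 \<le> query_value n f ?S (bits y) i"
    using seen_subset[OF y stop_le[OF y]] iI by (intro query_value_ge_1) auto
  ultimately show False using postponed[of "stop y"] i by (simp add: seen_def)
qed

definition cost :: "real \<Rightarrow> real" where
  "cost \<kappa> = (\<Sum>y\<in>outcomes n. outcome_prob n p y *
     (\<kappa> * real (card (st1 (A (stop y) y))) + real (card (st2 (A (stop y) y)))))"

lemma cost_eq:
  "cost \<kappa> = \<kappa> * (opt_value n f {} x + total_regret) + (1 - \<kappa>) * cost 0"
proof -
  have "cost \<kappa> = \<kappa> * (\<Sum>y\<in>outcomes n. outcome_prob n p y * real (card (seen (stop y) y))) + (1 - \<kappa>) * cost 0"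
    unfolding cost_def sum_distrib_left sum.distrib[symmetric]
    by (intro sum.cong refl) (simp add: card_seen[OF _ stop_le] algebra_simps)
  then show ?thesis by (simp only: expected_seen[of x])
qed

lemma cost_no_wasted_hints:
  assumes "\<And>y. y \<in> outcomes n \<Longrightarrow> st1 (A (stop y) y) = {}"
  shows "cost \<kappa> = opt_value n f {} x + total_regret"
proof -
  have "cost \<kappa> = cost 1" unfolding cost_def using assms by (intro sum.cong refl) simp
  then show ?thesis using cost_eq[of 1 x] by simp
qed

text \<open>Without pending hints the cost is \<open>a\<close> plus the regret, where \<open>a = opt_value n f {} x\<close>. With a
  pending hint the regret is at least \<open>\<delta>\<close>, and the definition of \<open>kappa_0\<close> makes this loss balance
  the discount \<open>1 - \<kappa>\<close> on at most \<open>n\<close> hints.\<close>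

lemma cost_lower_bound:
  assumes "1 \<le> n"
  shows "opt_value n f {} x \<le> cost (kappa_0 n p)"
proof (cases "\<forall>y\<in>outcomes n. st1 (A (stop y) y) = {}")
  case True
  then show ?thesis using cost_no_wasted_hints[of _ x] total_regret_nonneg by simp
next
  case False
  define \<delta> where "\<delta> = ((1 - p) / 2) ^ n"
  define \<kappa> where "\<kappa> = kappa_0 n p"
  have \<delta>: "0 < \<delta>" using p by (simp add: \<delta>_def)
  have \<kappa>: "0 < \<kappa>" "\<kappa> < 1" "\<kappa> * \<delta> = (1 - \<kappa>) * real n"
    using \<delta> assms unfolding \<kappa>_def kappa_0_def \<delta>_def[symmetric] by (auto simp: field_simps add_pos_pos)
  have "\<delta> \<le> total_regret"
    using False wasted_hint_regret total_regret_ge unfolding \<delta>_def by blast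
  then have "\<kappa> * \<delta> \<le> \<kappa> * total_regret" using \<kappa>(1) by simp
  moreover have "(1 - \<kappa>) * opt_value n f {} x \<le> (1 - \<kappa>) * real n"
    using \<kappa>(2) opt_value_le[of "{}" n f x] by (intro mult_left_mono) auto
  moreover have "0 \<le> (1 - \<kappa>) * cost 0"
    unfolding cost_def using \<kappa>(2) p outcome_prob_pos[of p n]
    by (intro mult_nonneg_nonneg sum_nonneg) (auto intro: less_imp_le)
  ultimately show ?thesis
    using cost_eq[of \<kappa> x] \<kappa>(3) unfolding \<kappa>_def[symmetric] by (simp add: algebra_simps)
qed

end


section \<open>Standard algorithms as algorithms with partial information\<close>

lemma queried_0 [simp]: "queried q x 0 = {}"
  and queried_Suc: "queried q x (Suc t) = insert (q (history q x t)) (queried q x t)"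
  by (simp_all add: queried_def)

lemma set_history: "set (history q x t) = (\<lambda>i. (i, x i)) ` queried q x t"
  by (induction t) (simp_all add: queried_Suc)

lemma history_cong:
  "(\<And>i. i \<in> queried q x t \<Longrightarrow> x i = x' i) \<Longrightarrow> history q x' t = history q x t"
proof (induction t)
  case (Suc t)
  then have "history q x' t = history q x t" by (simp add: queried_Suc)
  then show ?case using Suc.prems[of "q (history q x t)"] by (simp add: queried_Suc)
qed simp

lemma standard_choice:
  "q \<in> standard_algorithms n \<Longrightarrow> x \<in> cube n \<Longrightarrow> t < n \<Longrightarrow> q (history q x t) \<in> {1..n} - queried q x t"
  by (simp add: standard_algorithms_def)

lemma queried_bounds:
  assumes "q \<in> standard_algorithms n" "x \<in> cube n" "t \<le> n"
  shows "queried q x t \<subseteq> {1..n} \<and> card (queried q x t) = t"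
  using assms(3)
proof (induction t)
  case (Suc t)
  then have "queried q x t \<subseteq> {1..n}" "card (queried q x t) = t" by auto
  moreover from this have "finite (queried q x t)" using finite_subset by blast
  ultimately show ?case using standard_choice[OF assms(1,2), of t] Suc.prems by (simp add: queried_Suc)
qed simp

lemma queried_all:
  assumes "q \<in> standard_algorithms n" "x \<in> cube n"
  shows "queried q x n = {1..n}"
  using queried_bounds[OF assms, of n] by (intro card_subset_eq) auto

text \<open>Follow the standard algorithm \<open>q\<close>, reading each bit immediately after its hint. The second
  component is thus nonempty only at odd times.\<close>

definition interleave :: "nat \<Rightarrow> strategy \<Rightarrow> (nat \<Rightarrow> 'w \<Rightarrow> bool) \<Rightarrow> nat \<Rightarrow> 'w \<Rightarrow> state" where
  "interleave n q X t \<omega> =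
     (let x = (\<lambda>i\<in>{1..n}. X i \<omega>); Q = queried q x (t div 2);
          H = (if odd t then {q (history q x (t div 2))} else {})
      in ({1..n} - Q - H, H, Q))"

lemma restrict_in_cube: "restrict x {1..n} \<in> cube n"
  by (simp add: cube_def)

lemma interleave_even:
  "interleave n q X (2 * s) \<omega> =
     (let x = (\<lambda>i\<in>{1..n}. X i \<omega>) in ({1..n} - queried q x s, {}, queried q x s))"
  by (simp add: interleave_def Let_def)

lemma interleave_odd:
  "interleave n q X (Suc (2 * s)) \<omega> =
     (let x = (\<lambda>i\<in>{1..n}. X i \<omega>); i = q (history q x s)
      in ({1..n} - queried q x s - {i}, {i}, queried q x s))"
  by (simp add: interleave_def Let_def)

lemma interleave_algorithm:
  fixes M :: "'w measure"
  assumes q: "q \<in> standard_algorithms n"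
  shows "interleave n q X \<in> partial_algorithms M n Z X"
  unfolding partial_algorithms_def mem_Collect_eq
proof (intro conjI ballI allI impI)
  fix \<omega>
  define x where "x = (\<lambda>i\<in>{1..n}. X i \<omega>)"
  have x: "x \<in> cube n" unfolding x_def by (rule restrict_in_cube)
  show "interleave n q X 0 \<omega> = ({1..n}, {}, {})" by (simp add: interleave_def Let_def)
  show "interleave n q X (2 * n) \<omega> = ({}, {}, {1..n})"
    unfolding interleave_even x_def[symmetric] by (simp add: queried_all[OF q x])
  fix t :: nat
  show "ordered_partition n (interleave n q X t \<omega>)" if "t \<le> 2 * n"
  proof (cases "even t")
    case True
    then obtain s where "t = 2 * s" by blast
    then show ?thesis using that queried_bounds[OF q x, of s]
      unfolding ordered_partition_def \<open>t = _\<close> interleave_even x_def[symmetric] by auto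
  next
    case False
    then obtain s where s: "t = Suc (2 * s)" by (metis oddE Suc_eq_plus1)
    then have "s < n" using that by simp
    then show ?thesis using queried_bounds[OF q x, of s] standard_choice[OF q x, of s]
      unfolding ordered_partition_def s interleave_odd x_def[symmetric] Let_def by auto
  qed
  show "query_step (interleave n q X t \<omega>) (interleave n q X (Suc t) \<omega>)" if "t < 2 * n"
  proof (cases "even t")
    case True
    then obtain s where s: "t = 2 * s" by blast
    then show ?thesis using that standard_choice[OF q x, of s]
      unfolding query_step_def s interleave_even interleave_odd x_def[symmetric] Let_def by auto
  next
    case False
    then obtain s where s: "t = Suc (2 * s)" by (metis oddE Suc_eq_plus1)
    have "Suc t = 2 * Suc s" using s by simp
    then show ?thesis
      unfolding query_step_def \<open>Suc t = _\<close> interleave_even unfolding s interleave_odd x_def[symmetric] Let_def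
      by (auto simp: queried_Suc)
  qed
next
  fix t \<omega> \<omega>'
  assume same: "interleave n q X t \<omega> = interleave n q X t \<omega>' \<and>
    (\<forall>i\<in>st1 (interleave n q X t \<omega>). Z i \<omega> = Z i \<omega>') \<and>
    (\<forall>i\<in>st2 (interleave n q X t \<omega>). X i \<omega> = X i \<omega>')"
  define x where "x = (\<lambda>i\<in>{1..n}. X i \<omega>)"
  define x' where "x' = (\<lambda>i\<in>{1..n}. X i \<omega>')"
  have "queried q x (t div 2) = st2 (interleave n q X t \<omega>)"
    by (simp add: interleave_def Let_def x_def)
  then have "history q x' (t div 2) = history q x (t div 2)"
    using same by (intro history_cong) (auto simp: x_def x'_def)
  moreover from this have "history q x' (Suc t div 2) = history q x (Suc t div 2) \<or> odd t"
    by auto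
  moreover have "Suc t div 2 = Suc (t div 2)" if "odd t" using that by presburger
  ultimately show "interleave n q X (Suc t) \<omega> = interleave n q X (Suc t) \<omega>'"
    unfolding interleave_def x_def[symmetric] x'_def[symmetric]
    by (cases "even t") (auto simp: Let_def queried_Suc queried_def)
qed

text \<open>New bits are read only in the steps that lead to an even time, so stopping takes place at an
  even time.\<close>

lemma stop_time_interleave:
  fixes X :: "nat \<Rightarrow> 'w \<Rightarrow> bool" and \<omega> :: 'w
  assumes q: "q \<in> standard_algorithms n"
  defines "x \<equiv> (\<lambda>i\<in>{1..n}. X i \<omega>)"
  shows "stop_time n f X (interleave n q X) \<omega> = 2 * num_queries n f q x"
    and "num_queries n f q x \<le> n"
proof -
  have x: "x \<in> cube n" unfolding x_def by (rule restrict_in_cube)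
  let ?D = "\<lambda>s. determined n f (queried q x s) x"
  have "?D n" unfolding queried_all[OF q x] by (rule determined_all)
  then show le: "num_queries n f q x \<le> n" unfolding num_queries_def by (rule Least_le)
  have det: "?D (num_queries n f q x)"
    unfolding num_queries_def using \<open>?D n\<close> by (rule LeastI[of ?D])
  have st2: "st2 (interleave n q X t \<omega>) = queried q x (t div 2)" for t
    by (simp add: interleave_def Let_def x_def)
  have same: "determined n f (queried q x s) (\<lambda>i. X i \<omega>) = ?D s" if "s \<le> n" for s
    using queried_bounds[OF q x that] by (intro determined_cong) (auto simp: x_def)
  show "stop_time n f X (interleave n q X) \<omega> = 2 * num_queries n f q x"
    unfolding stop_time_def st2
  proof (rule Least_equality)
    show "determined n f (queried q x (2 * num_queries n f q x div 2)) (\<lambda>i. X i \<omega>)"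
      using det same[OF le] by simp
    fix t assume t: "determined n f (queried q x (t div 2)) (\<lambda>i. X i \<omega>)"
    show "2 * num_queries n f q x \<le> t"
    proof (rule ccontr)
      assume "\<not> ?thesis"
      then have less: "t div 2 < num_queries n f q x" by auto
      then have "\<not> ?D (t div 2)" unfolding num_queries_def by (rule not_less_Least)
      then show False using t same[of "t div 2"] less le by simp
    qed
  qed
qed

lemma interleave_at_stop_time:
  fixes X :: "nat \<Rightarrow> 'w \<Rightarrow> bool" and \<omega> :: 'w and f :: "(nat \<Rightarrow> bool) \<Rightarrow> bool"
  assumes q: "q \<in> standard_algorithms n"
  defines "x \<equiv> (\<lambda>i\<in>{1..n}. X i \<omega>)"
  defines "a \<equiv> interleave n q X (stop_time n f X (interleave n q X) \<omega>) \<omega>"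
  shows "st1 a = {}" "card (st2 a) = num_queries n f q x"
proof -
  have "card (queried q x (num_queries n f q x)) = num_queries n f q x"
    unfolding x_def by (rule conjunct2[OF queried_bounds[OF q restrict_in_cube stop_time_interleave(2)[OF q]]])
  then show "st1 a = {}" "card (st2 a) = num_queries n f q x"
    unfolding a_def stop_time_interleave(1)[OF q] interleave_even x_def[symmetric] by (simp_all add: Let_def)
qed

lemma canonical_interleave:
  assumes "1 / 2 < p" "p < 1" "q \<in> standard_algorithms n"
  shows "canonical_algorithm n p (interleave n q (\<lambda>i y. snd (y i)))"
  using assms interleave_algorithm by (intro canonical_algorithm.intro)

lemma cost_interleave:
  assumes "1 / 2 < p" "p < 1" and q: "q \<in> standard_algorithms n"
  shows "canonical_algorithm.cost n f p (interleave n q (\<lambda>i y. snd (y i))) \<kappa> =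
      measure_pmf.expectation (pmf_of_set (cube n)) (\<lambda>x. real (num_queries n f q x))"
proof -
  interpret canonical_algorithm n f p "interleave n q (\<lambda>i y. snd (y i))"
    by (rule canonical_interleave[OF assms])
  show ?thesis
    unfolding cost_def sum_outcome_prob_bits[symmetric, of n _ p] interleave_at_stop_time[OF q] by simp
qed

text \<open>The accounting identity for a standard algorithm, obtained from its interleaved version, which
  stops without pending hints.\<close>

lemma standard_cost_eq_regret:
  assumes "1 / 2 < p" "p < 1" and q: "q \<in> standard_algorithms n"
  shows "measure_pmf.expectation (pmf_of_set (cube n)) (\<lambda>x. real (num_queries n f q x)) =
      opt_value n f {} x0 + canonical_algorithm.total_regret n f p (interleave n q (\<lambda>i y. snd (y i)))"
proof -
  interpret canonical_algorithm n f p "interleave n q (\<lambda>i y. snd (y i))"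
    by (rule canonical_interleave[OF assms])
  show ?thesis
    using cost_no_wasted_hints[OF interleave_at_stop_time(1)[OF q], of 0 x0]
    unfolding cost_interleave[OF assms, of f 0] .
qed

text \<open>The greedy algorithm for \<open>opt_value\<close>. The values of the revealed bits are recovered from the
  history; once \<open>f\<close> is determined, any new bit will do.\<close>

definition optimal_choice :: "nat \<Rightarrow> ((nat \<Rightarrow> bool) \<Rightarrow> bool) \<Rightarrow> strategy" where
  "optimal_choice n f h =
     (let S = fst ` set h; x = (\<lambda>i. (i, True) \<in> set h)
      in SOME i. i \<in> {1..n} - S \<and> (determined n f S x \<or> opt_value n f S x = query_value n f S x i))"

lemma optimal_choice_history:
  fixes n f x t
  defines "S \<equiv> queried (optimal_choice n f) x t"
  defines "i \<equiv> optimal_choice n f (history (optimal_choice n f) x t)"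
  assumes S: "S \<subseteq> {1..n}" and t: "t < n"
  shows "i \<in> {1..n} - S" "determined n f S x \<or> query_value n f S x i = opt_value n f S x"
proof -
  let ?q = "optimal_choice n f"
  define x' where "x' = (\<lambda>i. (i, True) \<in> set (history ?q x t))"
  have same: "x' j = x j" if "j \<in> S" for j
    using that unfolding x'_def set_history S_def by auto
  have len: "length (history ?q x s) = s" for s by (induction s) auto
  have "card S \<le> t" unfolding S_def queried_def
    using card_image_le[of "set (history ?q x t)" fst] card_length[of "history ?q x t"] len[of t] by simp
  then have "{1..n} - S \<noteq> {}" using t S by (metis Diff_eq_empty_iff card_atLeastAtMost diff_Suc_1 not_le subset_antisym)
  then have "\<exists>i. i \<in> {1..n} - S \<and> (determined n f S x' \<or> opt_value n f S x' = query_value n f S x' i)"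
    using opt_value_attained[OF S, of f x'] by blast
  then have i: "i \<in> {1..n} - S \<and> (determined n f S x' \<or> opt_value n f S x' = query_value n f S x' i)"
    unfolding i_def optimal_choice_def[of n f "history ?q x t"] Let_def queried_def[symmetric] S_def[symmetric]
      x'_def[symmetric] by (rule someI_ex)
  then show "i \<in> {1..n} - S" by blast
  show "determined n f S x \<or> query_value n f S x i = opt_value n f S x"
    using i determined_cong[of S x' x n f] opt_value_cong[OF S, of x' x f]
      query_value_cong[OF S, of i x' x f] same by auto
qed

lemma optimal_choice_standard: "optimal_choice n f \<in> standard_algorithms n"
  unfolding standard_algorithms_def mem_Collect_eq
proof (intro ballI allI impI)
  fix x t assume "t < n"
  have "queried (optimal_choice n f) x s \<subseteq> {1..n}" if "s \<le> n" for s
    using that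
  proof (induction s)
    case (Suc s)
    then show ?case using optimal_choice_history(1)[of n f x s] by (auto simp: queried_Suc)
  qed simp
  then show "optimal_choice n f (history (optimal_choice n f) x t) \<in> {1..n} - queried (optimal_choice n f) x t"
    using \<open>t < n\<close> by (intro optimal_choice_history(1)) auto
qed

text \<open>Before the stopping time \<open>f\<close> is undetermined, so every query counted by the regret is a
  minimiser of \<open>query_value\<close>.\<close>

lemma total_regret_optimal_choice:
  assumes "1 / 2 < p" "p < 1"
  shows "canonical_algorithm.total_regret n f p (interleave n (optimal_choice n f) (\<lambda>i y. snd (y i))) = 0"
proof -
  let ?q = "optimal_choice n f"
  note q = optimal_choice_standard[of n f]
  interpret canonical_algorithm n f p "interleave n ?q (\<lambda>i y. snd (y i))"
    by (rule canonical_interleave[OF assms q])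
  have "regret t y = 0" if y: "y \<in> outcomes n" for t y
  proof (cases "asks t y")
    case True
    define x where "x = restrict (bits y) {1..n}"
    have x: "x \<in> cube n" unfolding x_def by (rule restrict_in_cube)
    note ask = asks_cases[OF y True]
    have "even t"
    proof (rule ccontr)
      assume "odd t"
      then obtain s where s: "t = Suc (2 * s)" by (metis oddE Suc_eq_plus1)
      then have "Suc t = 2 * Suc s" by simp
      then have "seen (Suc t) y = seen t y"
        unfolding seen_def \<open>Suc t = _\<close> interleave_even unfolding s interleave_odd Let_def
        by (simp add: queried_Suc)
      then show False using True by (simp add: asks_def)
    qed
    then obtain s where s: "t = 2 * s" by blast
    have sn: "s < n" using s ask(1) by simp
    have S: "seen t y = queried ?q x s" unfolding seen_def s interleave_even x_def[symmetric] by simp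
    have "seen (Suc t) y = insert (?q (history ?q x s)) (queried ?q x s)"
      unfolding seen_def s interleave_odd x_def[symmetric] by (simp add: Let_def)
    then have i: "asked t y = ?q (history ?q x s)"
      using standard_choice[OF q x sn] unfolding asked_def S by (simp add: insert_Diff_if)
    have sub: "queried ?q x s \<subseteq> {1..n}" using queried_bounds[OF q x, of s] sn by simp
    have agree: "\<And>j. j \<in> queried ?q x s \<Longrightarrow> bits y j = x j" using sub by (auto simp: x_def)
    have "\<not> determined n f (queried ?q x s) (bits y)"
    proof -
      have "t < stop y" using True by (simp add: asks_def)
      then have "\<not> determined n f (st2 (interleave n ?q (\<lambda>i y. snd (y i)) t y)) (bits y)"
        using less_stop_iff[OF y, of t] by blast
      then show ?thesis unfolding s interleave_even x_def[symmetric] by simp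
    qed
    then have "\<not> determined n f (queried ?q x s) x"
      using determined_cong[of "queried ?q x s" "bits y" x] agree by simp
    then have "query_value n f (queried ?q x s) x (asked t y) = opt_value n f (queried ?q x s) x"
      using optimal_choice_history(2)[OF sub sn] i by auto
    moreover have "query_value n f (queried ?q x s) (bits y) (asked t y) = query_value n f (queried ?q x s) x (asked t y)"
      using ask(2) agree by (intro query_value_cong[OF sub]) auto
    moreover have "opt_value n f (queried ?q x s) (bits y) = opt_value n f (queried ?q x s) x"
      using agree by (intro opt_value_cong[OF sub]) auto
    ultimately show ?thesis using True by (simp add: regret_def S)
  qed (simp add: regret_def)
  then show ?thesis unfolding total_regret_def by simp
qed

text \<open>Dynamic programming is correct: the cost of any standard algorithm is \<open>opt_value\<close> plus a
  nonnegative regret, which vanishes for the greedy algorithm.\<close>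

lemma standard_complexity_eq: "standard_complexity n f = opt_value n f {} x"
proof -
  let ?E = "\<lambda>q. measure_pmf.expectation (pmf_of_set (cube n)) (\<lambda>x. real (num_queries n f q x))"
  \<comment> \<open>The statement does not involve \<open>p\<close>: any law of the hints gives the same accounting of a standard
    algorithm, and \<open>3 / 4\<close> is an arbitrary choice.\<close>
  have p: "1 / 2 < (3 / 4 :: real)" "3 / 4 < (1 :: real)" by auto
  have ge: "opt_value n f {} x \<le> ?E q" if "q \<in> standard_algorithms n" for q
    using standard_cost_eq_regret[OF p that, where f = f and ?x0.0 = x]
      canonical_algorithm.total_regret_nonneg[OF canonical_interleave[OF p that], where f = f] by simp
  have eq: "?E (optimal_choice n f) = opt_value n f {} x"
    using standard_cost_eq_regret[OF p optimal_choice_standard[of n f], where f = f and ?x0.0 = x] total_regret_optimal_choice[OF p, of n f]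
    by simp
  show ?thesis unfolding standard_complexity_def
  proof (rule antisym)
    show "(INF q\<in>standard_algorithms n. ?E q) \<le> opt_value n f {} x"
      unfolding eq[symmetric] by (intro cINF_lower optimal_choice_standard bdd_belowI2[OF ge])
    show "opt_value n f {} x \<le> (INF q\<in>standard_algorithms n. ?E q)"
      using optimal_choice_standard by (intro cINF_greatest ge) auto
  qed
qed

section \<open>Reduction to the finite sample space\<close>

definition joint :: "nat \<Rightarrow> (nat \<Rightarrow> 'w \<Rightarrow> bool) \<Rightarrow> (nat \<Rightarrow> 'w \<Rightarrow> bool) \<Rightarrow> 'w \<Rightarrow> nat \<Rightarrow> bool \<times> bool" where
  "joint n Z X \<omega> = (\<lambda>i\<in>{1..n}. (Z i \<omega>, X i \<omega>))"

lemma joint_in_outcomes: "joint n Z X \<omega> \<in> outcomes n"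
  by (simp add: joint_def outcomes_def)

lemma model_pair_measurable:
  assumes "partial_information_model M n p Z X" "i \<in> {1..n}"
  shows "{\<omega>\<in>space M. (Z i \<omega>, X i \<omega>) \<in> V} \<in> sets M"
proof -
  interpret prob_space M using assms(1) by (simp add: partial_information_model_def)
  have "indep_vars (\<lambda>_. count_space UNIV) (\<lambda>i \<omega>. (Z i \<omega>, X i \<omega>)) {1..n}"
    using assms(1) by (simp add: partial_information_model_def)
  then have "(\<lambda>\<omega>. (Z i \<omega>, X i \<omega>)) \<in> measurable M (count_space UNIV)"
    using assms(2) by (simp add: indep_vars_def)
  then show ?thesis
    using measurable_sets[of "\<lambda>\<omega>. (Z i \<omega>, X i \<omega>)" M "count_space UNIV" V]
    by (simp add: vimage_def Int_def conj_commute)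
qed

text \<open>The three given probabilities, together with the total mass, form a linear system for the four
  values of a pair, and \<open>bit_prob p\<close> is its solution.\<close>

lemma model_pair_prob:
  assumes model: "partial_information_model M n p Z X" and i: "i \<in> {1..n}"
  shows "measure M {\<omega>\<in>space M. (Z i \<omega>, X i \<omega>) = v} = bit_prob p v"
proof -
  interpret prob_space M using model by (simp add: partial_information_model_def)
  define P where "P V = measure M {\<omega>\<in>space M. (Z i \<omega>, X i \<omega>) \<in> V}" for V
  have union: "P {u, v} = P {u} + P {v}" if "u \<noteq> v" for u v
  proof -
    have "{\<omega>\<in>space M. (Z i \<omega>, X i \<omega>) \<in> {u, v}} =
        {\<omega>\<in>space M. (Z i \<omega>, X i \<omega>) \<in> {u}} \<union> {\<omega>\<in>space M. (Z i \<omega>, X i \<omega>) \<in> {v}}" by auto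
    then show ?thesis unfolding P_def
      using that by (simp only:) (intro finite_measure_Union model_pair_measurable[OF model i], auto)
  qed
  have "P {(True, True), (True, False)} = measure M {\<omega>\<in>space M. Z i \<omega>}"
    "P {(True, True), (False, True)} = measure M {\<omega>\<in>space M. X i \<omega>}"
    "P {(True, True), (False, False)} = measure M {\<omega>\<in>space M. X i \<omega> = Z i \<omega>}"
    "P {(False, False), (True, False)} = measure M {\<omega>\<in>space M. \<not> X i \<omega>}"
    unfolding P_def by (intro arg_cong[where f = "measure M"]; auto)+
  moreover have "measure M {\<omega>\<in>space M. Z i \<omega>} = 1 / 2" "measure M {\<omega>\<in>space M. X i \<omega>} = 1 / 2"
    "measure M {\<omega>\<in>space M. X i \<omega> = Z i \<omega>} = p"
    using model i by (auto simp: partial_information_model_def)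
  moreover have "measure M {\<omega>\<in>space M. \<not> X i \<omega>} = 1 - measure M {\<omega>\<in>space M. X i \<omega>}"
    using model_pair_measurable[OF model i, of "{v. snd v}"] by (intro prob_neg) simp
  ultimately have "P {(True, True)} = p / 2" "P {(True, False)} = (1 - p) / 2"
    "P {(False, True)} = (1 - p) / 2" "P {(False, False)} = p / 2"
    by (simp_all add: union field_simps)
  then have "P {v} = bit_prob p v"
    by (cases v; cases "fst v"; cases "snd v") (simp_all add: bit_prob_def)
  then show ?thesis by (simp add: P_def)
qed

lemma joint_measurable:
  assumes "1 \<le> n" "partial_information_model M n p Z X" "y \<in> outcomes n"
  shows "{\<omega>\<in>space M. joint n Z X \<omega> = y} \<in> sets M"
    and "measure M {\<omega>\<in>space M. joint n Z X \<omega> = y} = outcome_prob n p y"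
proof -
  interpret prob_space M using assms(2) by (simp add: partial_information_model_def)
  let ?E = "\<lambda>i. (\<lambda>\<omega>. (Z i \<omega>, X i \<omega>)) -` {y i} \<inter> space M"
  have E: "?E i = {\<omega>\<in>space M. (Z i \<omega>, X i \<omega>) = y i}" for i by auto
  have ne: "{1..n} \<noteq> {}" using assms(1) by simp
  have "joint n Z X \<omega> = y \<longleftrightarrow> (\<forall>i\<in>{1..n}. (Z i \<omega>, X i \<omega>) = y i)" for \<omega>
  proof
    assume "\<forall>i\<in>{1..n}. (Z i \<omega>, X i \<omega>) = y i"
    then show "joint n Z X \<omega> = y"
      using assms(3) unfolding joint_def outcomes_def
      by (intro ext) (auto simp: PiE_iff extensional_def restrict_def)
  qed (auto simp: joint_def)
  then have eq: "{\<omega>\<in>space M. joint n Z X \<omega> = y} = (\<Inter>i\<in>{1..n}. ?E i)" using ne by auto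
  show "{\<omega>\<in>space M. joint n Z X \<omega> = y} \<in> sets M"
    unfolding eq E using model_pair_measurable[OF assms(2), of _ "{y _}"] ne
    by (intro sets.finite_INT) auto
  have "prob (\<Inter>i\<in>{1..n}. ?E i) = (\<Prod>i\<in>{1..n}. prob (?E i))"
    using assms(2) ne unfolding partial_information_model_def
    by (intro indep_varsD[where X = "\<lambda>i \<omega>. (Z i \<omega>, X i \<omega>)" and M' = "\<lambda>_. count_space UNIV" and I = "{1..n}"]) auto
  also have "\<dots> = outcome_prob n p y"
    unfolding outcome_prob_def E by (intro prod.cong refl model_pair_prob[OF assms(2)])
  finally show "measure M {\<omega>\<in>space M. joint n Z X \<omega> = y} = outcome_prob n p y" unfolding eq .
qed

lemma joint_expectation:
  fixes g :: "(nat \<Rightarrow> bool \<times> bool) \<Rightarrow> real"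
  assumes "1 \<le> n" "partial_information_model M n p Z X"
  shows "(\<integral>\<omega>. g (joint n Z X \<omega>) \<partial>M) = (\<Sum>y\<in>outcomes n. outcome_prob n p y * g y)"
proof -
  interpret prob_space M using assms(2) by (simp add: partial_information_model_def)
  let ?E = "\<lambda>y. {\<omega>\<in>space M. joint n Z X \<omega> = y}"
  have "g (joint n Z X \<omega>) = (\<Sum>y\<in>outcomes n. g y * indicator (?E y) \<omega>)" if "\<omega> \<in> space M" for \<omega>
  proof -
    have "(\<Sum>y\<in>outcomes n. g y * indicator (?E y) \<omega>) =
        (\<Sum>y\<in>outcomes n. if joint n Z X \<omega> = y then g y else 0)"
      using that by (intro sum.cong refl) (simp add: indicator_def)
    then show ?thesis by (simp add: finite_outcomes joint_in_outcomes)
  qed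
  then have "(\<integral>\<omega>. g (joint n Z X \<omega>) \<partial>M) = (\<integral>\<omega>. (\<Sum>y\<in>outcomes n. g y * indicator (?E y) \<omega>) \<partial>M)"
    by (intro Bochner_Integration.integral_cong refl) simp
  also have "\<dots> = (\<Sum>y\<in>outcomes n. \<integral>\<omega>. g y * indicator (?E y) \<omega> \<partial>M)"
    using joint_measurable(1)[OF assms]
    by (intro Bochner_Integration.integral_sum integrable_mult_right integrable_real_indicator)
      (auto simp: emeasure_eq_measure)
  also have "\<dots> = (\<Sum>y\<in>outcomes n. outcome_prob n p y * g y)"
    using joint_measurable[OF assms] by (intro sum.cong refl) (simp add: mult.commute sets.Int_space_eq2)
  finally show ?thesis .
qed

text \<open>Measurability of each step makes an algorithm a function of the pairs \<open>(Z i, X i)\<close>.\<close>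

lemma partial_algorithm_cong:
  assumes A: "A \<in> partial_algorithms M n Z X" and \<omega>: "\<omega> \<in> space M" "\<omega>' \<in> space M"
    and same: "joint n Z X \<omega> = joint n Z X \<omega>'" and t: "t \<le> 2 * n"
  shows "A t \<omega> = A t \<omega>'"
  using t
proof (induction t)
  case 0
  then show ?case using A \<omega> by (auto simp: partial_algorithms_def)
next
  case (Suc t)
  have eq: "Z i \<omega> = Z i \<omega>'" "X i \<omega> = X i \<omega>'" if "i \<in> {1..n}" for i
    using fun_cong[OF same, of i] that by (auto simp: joint_def)
  have "ordered_partition n (A t \<omega>)"
    using conjunct1[OF A[unfolded partial_algorithms_def mem_Collect_eq]] \<omega>(1) Suc.prems by auto
  then have "st1 (A t \<omega>) \<subseteq> {1..n}" "st2 (A t \<omega>) \<subseteq> {1..n}" by (auto simp: ordered_partition_def)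
  then have "A t \<omega> = A t \<omega>' \<and> (\<forall>i\<in>st1 (A t \<omega>). Z i \<omega> = Z i \<omega>') \<and> (\<forall>i\<in>st2 (A t \<omega>). X i \<omega> = X i \<omega>')"
    using Suc eq by auto
  moreover have "t < 2 * n" using Suc.prems by simp
  ultimately show ?case
    using conjunct2[OF A[unfolded partial_algorithms_def mem_Collect_eq]] \<omega> by blast
qed

text \<open>Every outcome has positive probability, hence is realised by some sample point. Running the
  algorithm at a chosen sample point for each outcome gives the canonical version.\<close>

lemma canonical_representation:
  assumes p: "1 / 2 < p" "p < 1" and n: "1 \<le> n" and model: "partial_information_model M n p Z X"
    and A: "A \<in> partial_algorithms M n Z X"
  obtains B where "canonical_algorithm n p B"
    and "\<And>\<omega> t. \<omega> \<in> space M \<Longrightarrow> t \<le> 2 * n \<Longrightarrow> A t \<omega> = B t (joint n Z X \<omega>)"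
proof -
  have "\<exists>\<omega>. \<omega> \<in> space M \<and> joint n Z X \<omega> = y" if "y \<in> outcomes n" for y
  proof (rule ccontr)
    assume "\<not> ?thesis"
    then have "{\<omega>\<in>space M. joint n Z X \<omega> = y} = {}" by blast
    then have "outcome_prob n p y = 0" using joint_measurable(2)[OF n model that] by (metis measure_empty)
    then show False using outcome_prob_pos[of p n y] p by simp
  qed
  then obtain rep where rep: "\<And>y. y \<in> outcomes n \<Longrightarrow> rep y \<in> space M \<and> joint n Z X (rep y) = y" by metis
  have rep_bits: "Z i (rep y) = fst (y i)" "X i (rep y) = snd (y i)" if "y \<in> outcomes n" "i \<in> {1..n}" for y i
  proof -
    have "y i = joint n Z X (rep y) i" using rep[OF that(1)] by simp
    then have "y i = (Z i (rep y), X i (rep y))" using that(2) by (simp add: joint_def)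
    then show "Z i (rep y) = fst (y i)" "X i (rep y) = snd (y i)" by simp_all
  qed
  define B where "B t y = A t (rep y)" for t y
  note A1 = conjunct1[OF A[unfolded partial_algorithms_def mem_Collect_eq]]
  note A2 = conjunct2[OF A[unfolded partial_algorithms_def mem_Collect_eq]]
  have "B \<in> partial_algorithms (count_space (outcomes n)) n (\<lambda>i y. fst (y i)) (\<lambda>i y. snd (y i))"
    unfolding partial_algorithms_def mem_Collect_eq space_count_space
  proof (intro conjI allI impI ballI)
    fix t y y' assume t: "t < 2 * n" and y: "y \<in> outcomes n" "y' \<in> outcomes n"
      and same: "B t y = B t y' \<and> (\<forall>i\<in>st1 (B t y). fst (y i) = fst (y' i)) \<and> (\<forall>i\<in>st2 (B t y). snd (y i) = snd (y' i))"
    have "ordered_partition n (A t (rep y))" using A1 rep y t by auto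
    then have "st1 (A t (rep y)) \<subseteq> {1..n}" "st2 (A t (rep y)) \<subseteq> {1..n}" by (auto simp: ordered_partition_def)
    then have "A t (rep y) = A t (rep y') \<and> (\<forall>i\<in>st1 (A t (rep y)). Z i (rep y) = Z i (rep y')) \<and>
        (\<forall>i\<in>st2 (A t (rep y)). X i (rep y) = X i (rep y'))"
      using same y by (auto simp: B_def rep_bits subset_iff)
    then show "B (Suc t) y = B (Suc t) y'" unfolding B_def using A2 t rep y by blast
  qed (use A1 rep in \<open>auto simp: B_def\<close>)
  then have "canonical_algorithm n p B" using p by (intro canonical_algorithm.intro)
  moreover have "A t \<omega> = B t (joint n Z X \<omega>)" if "\<omega> \<in> space M" "t \<le> 2 * n" for \<omega> t
    unfolding B_def using rep[OF joint_in_outcomes, of Z X \<omega>] that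
    by (intro partial_algorithm_cong[OF A]) auto
  ultimately show ?thesis by (rule that)
qed

lemma partial_cost_canonical:
  assumes n: "1 \<le> n" and model: "partial_information_model M n p Z X"
    and A: "A \<in> partial_algorithms M n Z X" and B: "canonical_algorithm n p B"
    and AB: "\<And>\<omega> t. \<omega> \<in> space M \<Longrightarrow> t \<le> 2 * n \<Longrightarrow> A t \<omega> = B t (joint n Z X \<omega>)"
  shows "partial_cost M n X \<kappa> A f = canonical_algorithm.cost n f p B \<kappa>"
proof -
  interpret canonical_algorithm n f p B by (rule B)
  have stop: "stop_time n f X A \<omega> = stop (joint n Z X \<omega>)" if \<omega>: "\<omega> \<in> space M" for \<omega>
  proof -
    let ?y = "joint n Z X \<omega>"
    note y = joint_in_outcomes[of n Z X \<omega>]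
    have "st2 (A (2 * n) \<omega>) = {1..n}" using AB[OF \<omega>] finish[OF y] by simp
    note A_stop = stop_time_properties[where A = A and \<omega> = \<omega> and X = X and f = f, OF this]
    have same: "determined n f (st2 (A s \<omega>)) (\<lambda>i. X i \<omega>) = determined n f (st2 (B s ?y)) (bits ?y)"
      if "s \<le> 2 * n" for s
    proof -
      have "st2 (B s ?y) \<subseteq> {1..n}" using seen_subset[OF y that] by (simp add: seen_def)
      then show ?thesis unfolding AB[OF \<omega> that] by (intro determined_cong) (auto simp: joint_def)
    qed
    show ?thesis
    proof (rule antisym)
      show "stop_time n f X A \<omega> \<le> stop ?y"
        using same[OF stop_le[OF y]] determined_stop[OF y] A_stop(3)[of "stop ?y"] by (meson not_le order_refl)
      show "stop ?y \<le> stop_time n f X A \<omega>"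
        using same[OF A_stop(1)] A_stop(2) less_stop_iff[OF y, of "stop_time n f X A \<omega>"] by (meson not_le order_refl)
    qed
  qed
  define g where "g y = \<kappa> * real (card (st1 (B (stop y) y))) + real (card (st2 (B (stop y) y)))" for y
  have "partial_cost M n X \<kappa> A f = (\<integral>\<omega>. g (joint n Z X \<omega>) \<partial>M)"
    unfolding partial_cost_def
    by (intro Bochner_Integration.integral_cong refl) (simp add: stop AB stop_le joint_in_outcomes g_def)
  also have "\<dots> = (\<Sum>y\<in>outcomes n. outcome_prob n p y * g y)"
    by (rule joint_expectation[OF n model])
  also have "\<dots> = cost \<kappa>" by (simp add: cost_def g_def)
  finally show ?thesis .
qed

text \<open>The lower bound holds for each algorithm separately, and it is attained by the greedy standard
  algorithm with interleaved hints.\<close>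

lemma partial_complexity_kappa_0:
  assumes p: "1 / 2 < p" "p < 1" and n: "1 \<le> n" and model: "partial_information_model M n p Z X"
  shows "partial_complexity M n Z X (kappa_0 n p) f = opt_value n f {} x"
proof -
  let ?c = "\<lambda>A. partial_cost M n X (kappa_0 n p) A f"
  have ge: "opt_value n f {} x \<le> ?c A" if A: "A \<in> partial_algorithms M n Z X" for A
  proof -
    obtain B where B: "canonical_algorithm n p B"
      "\<And>\<omega> t. \<omega> \<in> space M \<Longrightarrow> t \<le> 2 * n \<Longrightarrow> A t \<omega> = B t (joint n Z X \<omega>)"
      using canonical_representation[OF p n model A] by blast
    have "?c A = canonical_algorithm.cost n f p B (kappa_0 n p)"
      by (rule partial_cost_canonical[OF n model A B])
    then show ?thesis using canonical_algorithm.cost_lower_bound[OF B(1) n, where f = f and x = x] by simp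
  qed
  let ?q = "optimal_choice n f"
  let ?A = "interleave n ?q X"
  have A: "?A \<in> partial_algorithms M n Z X" by (rule interleave_algorithm[OF optimal_choice_standard])
  have "?c ?A = canonical_algorithm.cost n f p (interleave n ?q (\<lambda>i y. snd (y i))) (kappa_0 n p)"
  proof (rule partial_cost_canonical[OF n model A canonical_interleave[OF p optimal_choice_standard]])
    fix \<omega> t
    have "(\<lambda>i\<in>{1..n}. X i \<omega>) = (\<lambda>i\<in>{1..n}. snd (joint n Z X \<omega> i))" by (intro ext) (simp add: joint_def)
    then show "?A t \<omega> = interleave n ?q (\<lambda>i y. snd (y i)) t (joint n Z X \<omega>)" by (simp add: interleave_def)
  qed
  also have "\<dots> = opt_value n f {} x"
    unfolding cost_interleave[OF p optimal_choice_standard]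
    using standard_cost_eq_regret[OF p optimal_choice_standard[of n f], where f = f and ?x0.0 = x] total_regret_optimal_choice[OF p, of n f] by simp
  finally have eq: "?c ?A = opt_value n f {} x" .
  show ?thesis unfolding partial_complexity_def
  proof (rule antisym)
    show "(INF A\<in>partial_algorithms M n Z X. ?c A) \<le> opt_value n f {} x"
      unfolding eq[symmetric] by (intro cINF_lower A bdd_belowI2[OF ge])
    show "opt_value n f {} x \<le> (INF A\<in>partial_algorithms M n Z X. ?c A)"
      using A by (intro cINF_greatest ge) auto
  qed
qed

theorem theorem7p3:
  fixes n :: nat and p :: real
    and f :: "(nat \<Rightarrow> bool) \<Rightarrow> bool"
    and M :: "'w measure"
    and Z X :: "nat \<Rightarrow> 'w \<Rightarrow> bool"
  assumes "1 \<le> n"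
    and "1/2 < p" and "p < 1"
    and "partial_information_model M n p Z X"
  shows "kappa_c M n Z X f \<le> kappa_0 n p"
proof -
  have "0 \<le> kappa_0 n p" "kappa_0 n p \<le> 1"
    using assms(3) unfolding kappa_0_def by (auto simp: divide_le_eq_1 intro!: add_nonneg_nonneg)
  moreover have "partial_complexity M n Z X (kappa_0 n p) f = standard_complexity n f"
    unfolding partial_complexity_kappa_0[OF assms(2,3,1,4), of f "\<lambda>_. False"]
    by (rule standard_complexity_eq[symmetric])
  ultimately show ?thesis
    unfolding kappa_c_def by (intro cInf_lower bdd_belowI[of _ 0]) auto
qed

end
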